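(* Let $X$ be a metrizable (real) locally convex space and let $C\subset X$ be a nonempty closed convex bounded subset of $X$. The following assertions are equivalent: (1) Each nonempty closed convex subset of $C$ has the weak-AFPP. (2) $C$ contains no $\ell_1$-sequence.
   Context: Vector spaces are real. A nonempty bounded closed convex subset $D$ of a Hausdorff topological vector space $X$ (with topological dual $X^*$) has the weak-AFPP (weak approximate fixed point property) if for every continuous mapping $f\colon D\to D$ (continuous for the original topology of $X$) there is a sequence $(x_n)$ in $D$ such that $x^*(x_n-f(x_n))\to 0$ for all $x^*\in X^*$. Let $\ell_1^0$ be the subspace of $\ell_1$ formed by elements with only finitely many nonzero coordinates, equipped with the $\ell_1$-norm. A sequence $(x_n)$ in a topological vector space $X$ is an $\ell_1$-sequence if the linear mapping $T_0\colon\ell_1^0\to X$, $T_0((a_i)_{i=1}^\infty)=\sum_{i=1}^\infty a_ix_i$, is an isomorphism (linear homeomorphism) of $\ell_1^0$ onto $T_0(\ell_1^0)$. A set contains no $\ell_1$-sequence if no sequence of its elements is an $\ell_1$-sequence. *)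

theory Defs
  imports "HOL-Analysis.Analysis"
begin

text \<open>Real topological vector spaces. As in the class \<open>topological_monoid_add\<close>, joint continuity is
  stated with product filters. No separation axiom is included.\<close>

class real_topological_vector = real_vector + topological_ab_group_add +
  assumes tendsto_scaleR_Pair: "LIM z (nhds r \<times>\<^sub>F nhds x). fst z *\<^sub>R snd z :> nhds (r *\<^sub>R x)"

text \<open>The constant \<^const>\<open>convex\<close> cannot be used in a class specification, so convexity of \<open>V\<close>
  is unfolded here; the lemma \<open>open_convex_nhds_0\<close> states the axiom with the constant.\<close>

class real_locally_convex = real_topological_vector +
  assumes convex_nhds_0: "open U \<Longrightarrow> 0 \<in> U \<Longrightarrow> \<exists>V. open V \<and> 0 \<in> V \<and> V \<subseteq> U \<and>
    (\<forall>x\<in>V. \<forall>y\<in>V. \<forall>u\<ge>0. \<forall>v\<ge>0. u + v = 1 \<longrightarrow> u *\<^sub>R x + v *\<^sub>R y \<in> V)"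

lemma open_convex_nhds_0:
  fixes U :: "'a::real_locally_convex set"
  assumes "open U" "0 \<in> U"
  shows "\<exists>V. open V \<and> 0 \<in> V \<and> V \<subseteq> U \<and> convex V"
  using convex_nhds_0[OF assms] by (simp add: convex_def)

instance real_normed_vector \<subseteq> real_locally_convex
proof
  fix r :: real and x :: 'a
  have "((\<lambda>z. fst z *\<^sub>R snd z) \<longlongrightarrow> r *\<^sub>R x) (nhds r \<times>\<^sub>F nhds x)"
    by (intro tendsto_scaleR filterlim_fst filterlim_snd)
  then show "LIM z (nhds r \<times>\<^sub>F nhds x). fst z *\<^sub>R snd z :> nhds (r *\<^sub>R x)" .
next
  fix U :: "'a set"
  assume "open U" "0 \<in> U"
  then obtain e where "e > 0" "ball 0 e \<subseteq> U"
    by (meson open_contains_ball)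
  then show "\<exists>V. open V \<and> 0 \<in> V \<and> V \<subseteq> U \<and>
    (\<forall>x\<in>V. \<forall>y\<in>V. \<forall>u\<ge>0. \<forall>v\<ge>0. u + v = 1 \<longrightarrow> u *\<^sub>R x + v *\<^sub>R y \<in> V)"
    using convex_ball[of "0 :: 'a" e, unfolded convex_def]
    by (intro exI[of _ "ball 0 e"] conjI) simp_all
qed

text \<open>Boundedness in the sense of topological vector spaces, not with respect to a metric.\<close>

definition tvs_bounded :: "'a::real_topological_vector set \<Rightarrow> bool" where
  "tvs_bounded C \<longleftrightarrow>
     (\<forall>U. open U \<and> 0 \<in> U \<longrightarrow> (\<exists>s>0. \<forall>t>s. C \<subseteq> (\<lambda>x. t *\<^sub>R x) ` U))"

definition topological_dual :: "('a::real_topological_vector \<Rightarrow> real) set" where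
  "topological_dual = {\<phi>. linear \<phi> \<and> continuous_on UNIV \<phi>}"

definition weak_AFPP :: "'a::real_topological_vector set \<Rightarrow> bool" where
  "weak_AFPP D \<longleftrightarrow>
     (\<forall>f. continuous_on D f \<and> f ` D \<subseteq> D \<longrightarrow>
       (\<exists>x :: nat \<Rightarrow> 'a. range x \<subseteq> D \<and>
         (\<forall>\<phi>\<in>topological_dual. (\<lambda>n. \<phi> (x n - f (x n))) \<longlonglongrightarrow> 0)))"

text \<open>The space of finitely supported real sequences with the topology of the
  \<open>\<ell>\<^sub>1\<close>-norm. Coordinates are indexed from 0.\<close>

definition ell1_fin :: "(nat \<Rightarrow> real) set" where
  "ell1_fin = {a. finite {i. a i \<noteq> 0}}"

definition ell1_norm :: "(nat \<Rightarrow> real) \<Rightarrow> real" where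
  "ell1_norm a = (\<Sum>i | a i \<noteq> 0. \<bar>a i\<bar>)"

definition ell1_dist :: "(nat \<Rightarrow> real) \<Rightarrow> (nat \<Rightarrow> real) \<Rightarrow> real" where
  "ell1_dist a b = ell1_norm (\<lambda>i. a i - b i)"

lemma ell1_norm_eq:
  assumes "finite S" "{i. a i \<noteq> 0} \<subseteq> S"
  shows "ell1_norm a = (\<Sum>i\<in>S. \<bar>a i\<bar>)"
  unfolding ell1_norm_def using assms by (intro sum.mono_neutral_left) auto

interpretation ell1_fin: Metric_space ell1_fin ell1_dist
proof
  fix a b c :: "nat \<Rightarrow> real"
  show "0 \<le> ell1_dist a b"
    by (simp add: ell1_dist_def ell1_norm_def sum_nonneg)
  show "ell1_dist a b = ell1_dist b a"
    unfolding ell1_dist_def ell1_norm_def by (intro sum.cong) auto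
  assume ab: "a \<in> ell1_fin" "b \<in> ell1_fin"
  define S where "S = {i. a i \<noteq> 0} \<union> {i. b i \<noteq> 0}"
  have S: "finite S" using ab by (simp add: S_def ell1_fin_def)
  have "ell1_dist a b = (\<Sum>i\<in>S. \<bar>a i - b i\<bar>)"
    unfolding ell1_dist_def by (rule ell1_norm_eq[OF S]) (auto simp: S_def)
  moreover have "a = b \<longleftrightarrow> (\<forall>i\<in>S. a i = b i)"
  proof
    assume "\<forall>i\<in>S. a i = b i"
    moreover have "a i = 0 \<and> b i = 0" if "i \<notin> S" for i
      using that by (simp add: S_def)
    ultimately show "a = b"
      by (metis ext)
  qed simp
  ultimately show "ell1_dist a b = 0 \<longleftrightarrow> a = b"
    using S by (simp add: sum_nonneg_eq_0_iff)
  assume c: "c \<in> ell1_fin"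
  define T where "T = S \<union> {i. c i \<noteq> 0}"
  have T: "finite T" using S c by (simp add: T_def ell1_fin_def)
  have "ell1_dist a c = (\<Sum>i\<in>T. \<bar>a i - c i\<bar>)" "ell1_dist a b = (\<Sum>i\<in>T. \<bar>a i - b i\<bar>)"
    "ell1_dist b c = (\<Sum>i\<in>T. \<bar>b i - c i\<bar>)"
    unfolding ell1_dist_def by (rule ell1_norm_eq[OF T]; auto simp: T_def S_def)+
  moreover have "(\<Sum>i\<in>T. \<bar>a i - c i\<bar>) \<le> (\<Sum>i\<in>T. \<bar>a i - b i\<bar> + \<bar>b i - c i\<bar>)"
    by (rule sum_mono) simp
  ultimately show "ell1_dist a c \<le> ell1_dist a b + ell1_dist b c"
    by (simp only: sum.distrib)
qed

text \<open>The linear map \<open>T\<^sub>0\<close> determined by a sequence.\<close>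

definition ell1_map :: "(nat \<Rightarrow> 'a::real_vector) \<Rightarrow> (nat \<Rightarrow> real) \<Rightarrow> 'a" where
  "ell1_map x a = (\<Sum>i | a i \<noteq> 0. a i *\<^sub>R x i)"

definition ell1_sequence :: "(nat \<Rightarrow> 'a::real_topological_vector) \<Rightarrow> bool" where
  "ell1_sequence x \<longleftrightarrow>
     homeomorphic_map ell1_fin.mtopology (top_of_set (ell1_map x ` ell1_fin)) (ell1_map x)"

end

theory Submission
  imports Defs
begin

text \<open>
  If \<open>e\<close> is an \<open>\<ell>\<^sub>1\<close>-sequence in \<open>C\<close>, every bounded scalar sequence is the restriction of a continuous
  functional to \<open>e\<close> (Hahn--Banach). Points of the closed convex hull \<open>D\<close> of \<open>e\<close> have coordinates that
  form probability distributions on the natural numbers, and a map that sharpens the distribution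
  and shifts it by one step moves every point by a definite amount. As in the proof of Schur's
  theorem, a gliding hump yields a single functional that detects this displacement.

  Conversely, Brouwer's theorem shows that \<open>0\<close> is in the weak closure of \<open>{x - f x | x \<in> D}\<close>, and even
  of \<open>{x i - f (x i) | i}\<close> for some sequence \<open>x\<close> in \<open>D\<close>; let \<open>U\<close> be an ultrafilter on the indices along
  which \<open>x i - f (x i)\<close> tends weakly to \<open>0\<close>. On each polar, viewed as a compact set of scalar sequences,
  either the values of \<open>x\<close> oscillate little on sets from a countable subfamily of \<open>U\<close>, or there is an
  independent sequence of evaluations in the sense of Rosenthal, hence an \<open>\<ell>\<^sub>1\<close>-sequence in \<open>C\<close>; the
  same holds for \<open>f (x i)\<close>. In the first case the indices can be chosen successively in the countably
  many sets involved, which replaces the appeal to Rosenthal's theorem and to the angelicity of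
  spaces of Baire class one functions.
\<close>

section \<open>Topological vector spaces\<close>

lemma tendsto_scaleR_tvs [tendsto_intros]:
  fixes g :: "'b \<Rightarrow> 'a::real_topological_vector"
  assumes "(f \<longlongrightarrow> r) F" "(g \<longlongrightarrow> x) F"
  shows "((\<lambda>z. f z *\<^sub>R g z) \<longlongrightarrow> r *\<^sub>R x) F"
  using filterlim_compose[OF tendsto_scaleR_Pair filterlim_Pair[OF assms]] by simp

lemma continuous_on_scaleR_tvs [continuous_intros]:
  fixes g :: "'b::topological_space \<Rightarrow> 'a::real_topological_vector"
  assumes "continuous_on S f" "continuous_on S g"
  shows "continuous_on S (\<lambda>z. f z *\<^sub>R g z)"
  using assms unfolding continuous_on_def by (auto intro: tendsto_scaleR_tvs)

lemma symmetric_convex_nhds_0: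
  fixes U :: "'a::real_locally_convex set"
  assumes "open U" "0 \<in> U"
  obtains V where "open V" "0 \<in> V" "V \<subseteq> U" "convex V" "\<And>x. x \<in> V \<Longrightarrow> - x \<in> V"
proof -
  obtain V where V: "open V" "0 \<in> V" "V \<subseteq> U" "convex V" using open_convex_nhds_0[OF assms] by blast
  have "open (V \<inter> uminus -` V)" 
    using V(1) by (intro open_Int open_vimage continuous_intros) auto
  moreover have "uminus -` V = uminus ` V" by force
  then have "convex (uminus -` V)" using convex_negations[OF V(4)] by simp
  then have "convex (V \<inter> uminus -` V)" using V(4) by (intro convex_Int)
  ultimately show ?thesis using that[of "V \<inter> uminus -` V"] V by auto
qed

lemma bounded_on_nhds_continuous:
  fixes \<phi> :: "'a::real_topological_vector \<Rightarrow> real"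
  assumes lin: "linear \<phi>" and V: "open V" "0 \<in> V" "\<And>v. v \<in> V \<Longrightarrow> \<bar>\<phi> v\<bar> \<le> 1"
  shows "continuous_on UNIV \<phi>"
  unfolding continuous_on_def
proof
  fix x :: 'a
  show "(\<phi> \<longlongrightarrow> \<phi> x) (at x within UNIV)"
  proof (rule tendstoI)
    fix e :: real assume e: "e > 0"
    \<comment> \<open>The factor \<open>2 / e\<close> turns the bound 1 on \<open>V\<close> into
      \<open>e / 2\<close>, which is strictly below \<open>e\<close>.\<close>
    define W where "W = {y. (2 / e) *\<^sub>R (y - x) \<in> V}"
    have "open W"
      unfolding W_def by (intro open_vimage[OF V(1), unfolded vimage_def] continuous_intros)
    moreover have "x \<in> W" using V by (simp add: W_def)
    moreover have "dist (\<phi> y) (\<phi> x) < e" if "y \<in> W" for y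
    proof -
      have "\<bar>\<phi> ((2 / e) *\<^sub>R (y - x))\<bar> \<le> 1" using that V(3) by (simp add: W_def)
      moreover have "\<phi> ((2 / e) *\<^sub>R (y - x)) = 2 / e * (\<phi> y - \<phi> x)"
        by (simp only: linear_scale[OF lin] linear_diff[OF lin] real_scaleR_def)
      ultimately have "2 / e * \<bar>\<phi> y - \<phi> x\<bar> \<le> 1"
        using e by (simp add: abs_mult del: right_diff_distrib_numeral)
      then show ?thesis using e by (simp add: dist_real_def field_simps)
    qed
    ultimately show "\<forall>\<^sub>F y in at x. dist (\<phi> y) (\<phi> x) < e"
      by (auto simp: eventually_at_topological)
  qed
qed

lemma topological_dualI:
  "linear \<phi> \<Longrightarrow> open V \<Longrightarrow> 0 \<in> V \<Longrightarrow> (\<And>v. v \<in> V \<Longrightarrow> \<bar>\<phi> v\<bar> \<le> 1) \<Longrightarrow> \<phi> \<in> topological_dual"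
  unfolding topological_dual_def using bounded_on_nhds_continuous by blast

section \<open>Sublinear functionals and the Hahn--Banach theorem\<close>

definition sublinear :: "('a::real_vector \<Rightarrow> real) \<Rightarrow> bool" where
  "sublinear q \<longleftrightarrow> (\<forall>x y. q (x + y) \<le> q x + q y) \<and> (\<forall>c x. c \<ge> 0 \<longrightarrow> q (c *\<^sub>R x) = c * q x)"

lemma sublinear_0: "sublinear q \<Longrightarrow> q 0 = 0"
  unfolding sublinear_def by (metis order_refl mult_zero_left scaleR_zero_left)

lemma sublinear_minus: "sublinear q \<Longrightarrow> - q (- x) \<le> q x"
  using sublinear_0[of q] unfolding sublinear_def by (metis add.right_inverse neg_le_iff_le add_le_cancel_left minus_add_cancel diff_ge_0_iff_ge add.commute diff_minus_eq_add)

text \<open>Zorn's lemma for the reversed pointwise order. Every sublinear \<open>q\<close> below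
  \<open>p\<close> satisfies \<open>- p (- x) \<le> q x\<close>, so pointwise infima of chains are
  finite; comparability within the chain makes them subadditive.\<close>

lemma sublinear_minimal_exists:
  fixes p :: "'a::real_vector \<Rightarrow> real"
  assumes "sublinear p"
  obtains q where "sublinear q" "\<And>x. q x \<le> p x"
    "\<And>q' x. sublinear q' \<Longrightarrow> (\<And>x. q' x \<le> q x) \<Longrightarrow> q' = q"
proof -
  define A where "A = {q. sublinear q \<and> (\<forall>x. q x \<le> p x)}"
  define P where "P = (\<lambda>q q'. \<forall>x::'a. (q' x::real) \<le> q x)"
  have "\<exists>m\<in>A. \<forall>a\<in>A. P m a \<longrightarrow> a = m"
  proof (rule predicate_Zorn)
    show "partial_order_on A (relation_of P A)"
      by (rule partial_order_on_relation_ofI) (auto simp: P_def fun_eq_iff intro: order_trans antisym)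
    fix C assume C: "C \<in> Chains (relation_of P A)"
    then have CA: "C \<subseteq> A" and tot: "\<And>f g. f \<in> C \<Longrightarrow> g \<in> C \<Longrightarrow> P f g \<or> P g f"
      by (auto simp: Chains_def relation_of_def)
    show "\<exists>u\<in>A. \<forall>a\<in>C. P a u"
    proof (cases "C = {}")
      case True
      have "p \<in> A" using assms by (simp add: A_def)
      then show ?thesis using True by blast
    next
      case False
      define u where "u x = (INF q\<in>C. q x)" for x
      have sub: "sublinear q" "q x \<le> p x" if "q \<in> C" for q x using that CA by (auto simp: A_def)
      have lb: "- p (- x) \<le> q x" if "q \<in> C" for q x
        using sublinear_minus[OF sub(1)[OF that], of x] sub(2)[OF that, of "-x"] by linarith
      have bdd: "bdd_below ((\<lambda>q. q x) ` C)" for x using lb by (intro bdd_belowI2[of _ "- p (- x)"]) auto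
      have ule: "u x \<le> q x" if "q \<in> C" for q x
        unfolding u_def using bdd that by (intro cINF_lower) auto
      have ugr: "c \<le> u x" if "\<And>q. q \<in> C \<Longrightarrow> c \<le> q x" for c x
        unfolding u_def using False that by (intro cINF_greatest) auto
      have "sublinear u"
        unfolding sublinear_def
      proof (intro conjI allI impI)
        \<comment> \<open>The smaller one, \<open>q0\<close>, of two chain members gives the mixed
          estimate; the infima over \<open>q'\<close> and \<open>q\<close> are then taken one after
          the other.\<close>
        fix x y
        have 1: "u (x + y) \<le> q x + q' y" if q: "q \<in> C" "q' \<in> C" for q q'
        proof -
          obtain q0 where q0: "q0 \<in> C" "P q q0" "P q' q0"
            using tot[OF q] q by (auto simp: P_def)
          have "u (x + y) \<le> q0 x + q0 y"
            using ule[OF q0(1), of "x + y"] sub(1)[OF q0(1)] by (auto simp: sublinear_def intro: order_trans)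
          also have "\<dots> \<le> q x + q' y" using q0 by (auto simp: P_def intro: add_mono)
          finally show ?thesis .
        qed
        have "u (x + y) - q x \<le> u y" if "q \<in> C" for q using 1[OF that] by (intro ugr) (simp add: algebra_simps)
        then have "u (x + y) - u y \<le> u x" by (intro ugr) (simp add: algebra_simps)
        then show "u (x + y) \<le> u x + u y" by simp
      next
        fix c :: real and x assume c: "c \<ge> 0"
        have sc: "q (c *\<^sub>R x) = c * q x" if "q \<in> C" for q using sub(1)[OF that] c by (simp add: sublinear_def)
        show "u (c *\<^sub>R x) = c * u x"
        proof (cases "c = 0")
          case True
          then have z: "q 0 = 0" if "q \<in> C" for q using sc[OF that] by simp
          obtain q where q: "q \<in> C" using False by blast
          have "u 0 \<le> 0" using ule[OF q, of 0] z[OF q] by simp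
          moreover have "0 \<le> q 0" if "q \<in> C" for q using z[OF that] by simp
          then have "0 \<le> u 0" by (rule ugr)
          ultimately show ?thesis using True by simp
        next
          case False
          with c have c: "c > 0" by simp
          have "u (c *\<^sub>R x) / c \<le> q x" if "q \<in> C" for q
            using ule[OF that, of "c *\<^sub>R x"] sc[OF that] c by (simp add: field_simps)
          then have "u (c *\<^sub>R x) / c \<le> u x" by (rule ugr)
          moreover have "c * u x \<le> q (c *\<^sub>R x)" if "q \<in> C" for q
            using ule[OF that, of x] sc[OF that] c by simp
          then have "c * u x \<le> u (c *\<^sub>R x)" by (rule ugr)
          ultimately show ?thesis using c by (simp add: field_simps)
        qed
      qed
      moreover have "u x \<le> p x" for x
      proof -
        obtain q where "q \<in> C" using False by blast
        then show ?thesis using ule[of q x] sub(2)[of q x] by linarith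
      qed
      ultimately have "u \<in> A" by (simp add: A_def)
      then show ?thesis using ule by (auto simp: P_def)
    qed
  qed
  then obtain q where q: "q \<in> A" and min: "\<And>a. a \<in> A \<Longrightarrow> P q a \<Longrightarrow> a = q" by blast
  show ?thesis
  proof (rule that[of q])
    show "sublinear q" "q x \<le> p x" for x using q by (auto simp: A_def)
    fix q' assume "sublinear q'" "\<And>x. q' x \<le> q x"
    then show "q' = q" using q by (intro min) (auto simp: A_def P_def intro: order_trans)
  qed
qed

text \<open>The cone \<open>R\<close> encodes constraints \<open>t \<le> \<phi> x\<close>, which every linear \<open>\<phi> \<le> q\<close> satisfies.\<close>

lemma sublinear_Inf_cone:
  fixes p :: "'a::real_vector \<Rightarrow> real" and R :: "('a \<times> real) set"
  assumes p: "sublinear p" and R0: "(0, 0) \<in> R"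
    and Radd: "\<And>x t y u. (x, t) \<in> R \<Longrightarrow> (y, u) \<in> R \<Longrightarrow> (x + y, t + u) \<in> R"
    and Rsc: "\<And>x t c. (x, t) \<in> R \<Longrightarrow> c > 0 \<Longrightarrow> (c *\<^sub>R x, c * t) \<in> R"
    and Rp: "\<And>x t. (x, t) \<in> R \<Longrightarrow> t \<le> p x"
  obtains q where "sublinear q" "\<And>y. q y \<le> p y" "\<And>x t. (x, t) \<in> R \<Longrightarrow> q (- x) \<le> - t"
proof -
  have padd: "p (x + y) \<le> p x + p y" and psc: "c \<ge> 0 \<Longrightarrow> p (c *\<^sub>R x) = c * p x" for x y c
    using p by (auto simp: sublinear_def)
  define q where "q y = (INF (x, t)\<in>R. p (y + x) - t)" for y
  have lb: "- p (- y) \<le> p (y + x) - t" if "(x, t) \<in> R" for x y t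
    using padd[of "y + x" "- y"] Rp[OF that] by simp
  have le: "q y \<le> p (y + x) - t" if "(x, t) \<in> R" for x y t
    unfolding q_def using lb that
    by (intro cINF_lower2[OF _ that] bdd_belowI2[of _ "- p (- y)"]) auto
  have gr: "c \<le> q y" if "\<And>x t. (x, t) \<in> R \<Longrightarrow> c \<le> p (y + x) - t" for c y
    unfolding q_def using that R0 by (intro cINF_greatest) auto
  have "sublinear q"
    unfolding sublinear_def
  proof (intro conjI allI impI)
    fix y z
    have 1: "q (y + z) \<le> (p (y + x) - t) + (p (z + x') - t')"
      if "(x, t) \<in> R" "(x', t') \<in> R" for x t x' t'
      using le[OF Radd[OF that], of "y + z"] padd[of "y + x" "z + x'"]
      by (simp add: algebra_simps)
    have "q (y + z) - (p (y + x) - t) \<le> q z" if "(x, t) \<in> R" for x t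
      using 1[OF that] by (intro gr) (simp add: algebra_simps)
    then have "q (y + z) - q z \<le> q y" by (intro gr) (simp add: algebra_simps)
    then show "q (y + z) \<le> q y + q z" by simp
  next
    fix c :: real and y assume c: "c \<ge> 0"
    show "q (c *\<^sub>R y) = c * q y"
    proof (cases "c = 0")
      case True
      have "q 0 \<le> 0" using le[OF R0, of 0] sublinear_0[OF p] by simp
      moreover have "0 \<le> q 0" using Rp by (intro gr) simp
      ultimately show ?thesis using True by simp
    next
      case False
      with c have c: "c > 0" by simp
      have "q (c *\<^sub>R y) / c \<le> q y"
      proof (rule gr)
        fix x t assume "(x, t) \<in> R"
        from le[OF Rsc[OF this c], of "c *\<^sub>R y"] psc[of c "y + x"] c
        show "q (c *\<^sub>R y) / c \<le> p (y + x) - t" by (simp add: field_simps)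
      qed
      moreover have "c * q y \<le> q (c *\<^sub>R y)"
      proof (rule gr)
        fix x t assume "(x, t) \<in> R"
        from le[OF Rsc[OF this], of "1 / c" y] psc[of c "y + (1 / c) *\<^sub>R x"] c
        show "c * q y \<le> p (c *\<^sub>R y + x) - t" by (simp add: field_simps scaleR_add_right)
      qed
      ultimately show ?thesis using c by (simp add: field_simps)
    qed
  qed
  moreover have "q y \<le> p y" for y using le[OF R0, of y] by simp
  moreover have "q (- x) \<le> - t" if "(x, t) \<in> R" for x t using le[OF that, of "- x"] sublinear_0[OF p] by simp
  ultimately show ?thesis using that by blast
qed

text \<open>A minimal sublinear functional \<open>q\<close> below \<open>p\<close> is already
  linear: lowering it along the ray through \<open>z\<close> gives a sublinear functional below
  \<open>q\<close>, which must be \<open>q\<close> itself, and this forces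
  \<open>q (- z) = - q z\<close>.\<close>

lemma linear_minorant_exists:
  fixes p :: "'a::real_vector \<Rightarrow> real"
  assumes "sublinear p"
  obtains \<phi> where "linear \<phi>" "\<And>x. \<phi> x \<le> p x"
proof -
  obtain q where q: "sublinear q" "\<And>x. q x \<le> p x"
    and min: "\<And>q'. sublinear q' \<Longrightarrow> (\<And>x. q' x \<le> q x) \<Longrightarrow> q' = q"
    using sublinear_minimal_exists[OF assms] by metis
  have qadd: "q (x + y) \<le> q x + q y" and qsc: "c \<ge> 0 \<Longrightarrow> q (c *\<^sub>R x) = c * q x" for x y c
    using q(1) by (auto simp: sublinear_def)
  have neg: "q (- z) = - q z" for z
  proof -
    define R where "R = {(t *\<^sub>R z, t * q z) |t. t \<ge> 0}"
    obtain q' where q': "sublinear q'" "\<And>y. q' y \<le> q y" "\<And>x t. (x, t) \<in> R \<Longrightarrow> q' (- x) \<le> - t"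
    proof (rule sublinear_Inf_cone[OF q(1), of R])
      show "(0, 0) \<in> R" by (auto simp: R_def intro!: exI[of _ "0::real"])
      show "(x + y, t + u) \<in> R" if "(x, t) \<in> R" "(y, u) \<in> R" for x t y u
      proof -
        obtain a b where ab: "a \<ge> 0" "b \<ge> 0" "x = a *\<^sub>R z" "t = a * q z" "y = b *\<^sub>R z" "u = b * q z"
          using \<open>(x, t) \<in> R\<close> \<open>(y, u) \<in> R\<close> unfolding R_def by blast
        have "x + y = (a + b) *\<^sub>R z" "t + u = (a + b) * q z" "a + b \<ge> 0"
          using ab by (simp_all add: algebra_simps)
        then show ?thesis unfolding R_def by blast
      qed
      show "(c *\<^sub>R x, c * t) \<in> R" if "(x, t) \<in> R" "c > 0" for x t c
      proof -
        obtain a where a: "a \<ge> 0" "x = a *\<^sub>R z" "t = a * q z"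
          using \<open>(x, t) \<in> R\<close> unfolding R_def by blast
        have "c *\<^sub>R x = (c * a) *\<^sub>R z" "c * t = (c * a) * q z" "c * a \<ge> 0"
          using a \<open>c > 0\<close> by (simp_all add: algebra_simps)
        then show ?thesis unfolding R_def by blast
      qed
      show "t \<le> q x" if "(x, t) \<in> R" for x t using that by (auto simp: R_def qsc)
    qed blast
    have "(1 *\<^sub>R z, 1 * q z) \<in> R" unfolding R_def by (blast intro: zero_le_one)
    then have "q (- z) \<le> - q z" using q'(3)[of z "q z"] min[OF q'(1,2)] by simp
    moreover have "0 \<le> q z + q (- z)" using qadd[of z "- z"] sublinear_0[OF q(1)] by simp
    ultimately show ?thesis by simp
  qed
  have "linear q"
  proof (rule linearI)
    fix x y
    have "- q (x + y) \<le> - q x + - q y"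
      using qadd[of "- x" "- y"] neg[of "x + y"] neg[of x] neg[of y] by simp
    then show "q (x + y) = q x + q y" using qadd[of x y] by linarith
  next
    fix c x
    show "q (c *\<^sub>R x) = c *\<^sub>R q x"
    proof (cases "c \<ge> 0")
      case True then show ?thesis by (simp add: qsc)
    next
      case False
      then have "q ((- c) *\<^sub>R x) = (- c) * q x" by (intro qsc) simp
      then show ?thesis using neg[of "c *\<^sub>R x"] by simp
    qed
  qed
  then show ?thesis using that q(2) by blast
qed

text \<open>Every linear minorant of the lowered functional from \<open>sublinear_Inf_cone\<close>
  satisfies the constraints, as its value at \<open>- x\<close> shows.\<close>

lemma Mazur_Orlicz:
  fixes p :: "'a::real_vector \<Rightarrow> real" and R :: "('a \<times> real) set"
  assumes "sublinear p" "(0, 0) \<in> R"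
    "\<And>x t y u. (x, t) \<in> R \<Longrightarrow> (y, u) \<in> R \<Longrightarrow> (x + y, t + u) \<in> R"
    "\<And>x t c. (x, t) \<in> R \<Longrightarrow> c > 0 \<Longrightarrow> (c *\<^sub>R x, c * t) \<in> R"
    "\<And>x t. (x, t) \<in> R \<Longrightarrow> t \<le> p x"
  obtains \<phi> where "linear \<phi>" "\<And>x. \<phi> x \<le> p x" "\<And>x t. (x, t) \<in> R \<Longrightarrow> t \<le> \<phi> x"
proof -
  obtain q where q: "sublinear q" "\<And>y. q y \<le> p y" "\<And>x t. (x, t) \<in> R \<Longrightarrow> q (- x) \<le> - t"
    using sublinear_Inf_cone[OF assms] by metis
  obtain \<phi> where \<phi>: "linear \<phi>" "\<And>x. \<phi> x \<le> q x"
    using linear_minorant_exists[OF q(1)] by metis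
  show ?thesis
  proof (rule that[OF \<phi>(1)])
    show "\<phi> x \<le> p x" for x using \<phi>(2)[of x] q(2)[of x] by linarith
    show "t \<le> \<phi> x" if "(x, t) \<in> R" for x t
      using \<phi>(2)[of "- x"] q(3)[OF that] linear_neg[OF \<phi>(1), of x] by linarith
  qed
qed

section \<open>Minkowski functionals and functionals with prescribed values on a sequence\<close>

definition gauge_fun :: "'a::real_vector set \<Rightarrow> 'a \<Rightarrow> real" where
  "gauge_fun V x = Inf {t. t > 0 \<and> (\<exists>v\<in>V. x = t *\<^sub>R v)}"

lemma absorbing_open:
  fixes V :: "'a::real_topological_vector set"
  assumes "open V" "0 \<in> V"
  obtains s where "s > 0" "\<And>t. t \<ge> s \<Longrightarrow> (1 / t) *\<^sub>R x \<in> V"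
proof -
  have "((\<lambda>t. (1 / t) *\<^sub>R x) \<longlongrightarrow> 0 *\<^sub>R x) at_top"
    by (intro tendsto_intros tendsto_divide_0[OF tendsto_const] filterlim_at_top_imp_at_infinity filterlim_ident)
  then have "\<forall>\<^sub>F t in at_top. (1 / t) *\<^sub>R x \<in> V" using assms topological_tendstoD by force
  then obtain s where "\<And>t. t \<ge> s \<Longrightarrow> (1 / t) *\<^sub>R x \<in> V" by (auto simp: eventually_at_top_linorder)
  then show ?thesis using that[of "max 1 s"] by auto
qed

lemma gauge_fun_le: "t > 0 \<Longrightarrow> v \<in> V \<Longrightarrow> gauge_fun V (t *\<^sub>R v) \<le> t"
  unfolding gauge_fun_def by (intro cInf_lower bdd_belowI[of _ 0]) auto

lemma gauge_fun_ge:
  fixes V :: "'a::real_topological_vector set"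
  assumes "open V" "0 \<in> V" "\<And>t v. t > 0 \<Longrightarrow> v \<in> V \<Longrightarrow> x = t *\<^sub>R v \<Longrightarrow> c \<le> t"
  shows "c \<le> gauge_fun V x"
proof -
  obtain s where s: "s > 0" "\<And>t. t \<ge> s \<Longrightarrow> (1 / t) *\<^sub>R x \<in> V" using absorbing_open assms by metis
  then have "s \<in> {t. t > 0 \<and> (\<exists>v\<in>V. x = t *\<^sub>R v)}" by (auto intro!: bexI[of _ "(1 / s) *\<^sub>R x"])
  then show ?thesis unfolding gauge_fun_def using assms(3) by (intro cInf_greatest) auto
qed

lemma sublinear_gauge_fun:
  fixes V :: "'a::real_topological_vector set"
  assumes V: "open V" "0 \<in> V" "convex V"
  shows "sublinear (gauge_fun V)"
  unfolding sublinear_def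
proof (intro conjI allI impI)
  fix x y
  have 1: "gauge_fun V (x + y) \<le> t + u"
    if t: "t > 0" "v \<in> V" "x = t *\<^sub>R v" and u: "u > 0" "w \<in> V" "y = u *\<^sub>R w" for t v u w
  proof -
    define z where "z = (t / (t + u)) *\<^sub>R v + (u / (t + u)) *\<^sub>R w"
    have "z \<in> V" unfolding z_def
      using t u by (intro convexD[OF V(3)]) (auto simp flip: add_divide_distrib)
    moreover have "x + y = (t + u) *\<^sub>R z"
      using t u by (simp add: z_def scaleR_add_right)
    ultimately show ?thesis using gauge_fun_le[of "t + u" z V] t u by simp
  qed
  have "gauge_fun V (x + y) - t \<le> gauge_fun V y" if "t > 0" "v \<in> V" "x = t *\<^sub>R v" for t v
    using 1[OF that] by (intro gauge_fun_ge[OF V(1,2)]) (simp add: algebra_simps)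
  then have "gauge_fun V (x + y) - gauge_fun V y \<le> gauge_fun V x"
    by (intro gauge_fun_ge[OF V(1,2)]) (simp add: algebra_simps)
  then show "gauge_fun V (x + y) \<le> gauge_fun V x + gauge_fun V y" by simp
next
  fix c :: real and x :: 'a assume c: "c \<ge> 0"
  have le: "gauge_fun V (c *\<^sub>R x) \<le> c * gauge_fun V x" if c: "c > 0" for c x
  proof -
    have "gauge_fun V (c *\<^sub>R x) / c \<le> gauge_fun V x"
    proof (rule gauge_fun_ge[OF V(1,2)])
      fix t v assume "t > 0" "v \<in> V" "x = t *\<^sub>R v"
      then show "gauge_fun V (c *\<^sub>R x) / c \<le> t"
        using gauge_fun_le[of "c * t" v V] c by (simp add: field_simps)
    qed
    then show ?thesis using c by (simp add: field_simps)
  qed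
  show "gauge_fun V (c *\<^sub>R x) = c * gauge_fun V x"
  proof (cases "c = 0")
    case True
    have "gauge_fun V 0 \<le> t" if "t > 0" for t using gauge_fun_le[of t 0 V] V(2) that by simp
    then have "gauge_fun V 0 \<le> 0" by (rule field_le_epsilon[of _ 0, simplified])
    moreover have "0 \<le> gauge_fun V 0" by (intro gauge_fun_ge[OF V(1,2)]) simp
    ultimately show ?thesis using True by simp
  next
    case False
    then show ?thesis using c le[of c x] le[of "1 / c" "c *\<^sub>R x"]
      by (simp add: field_simps)
  qed
qed

lemma sum_ell1_support:
  assumes "finite S" "{i. a i \<noteq> 0} \<subseteq> S"
  shows "(\<Sum>i | a i \<noteq> 0. a i * b i) = (\<Sum>i\<in>S. a i * (b i :: real))"
    "ell1_map x a = (\<Sum>i\<in>S. a i *\<^sub>R x i)"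
  unfolding ell1_map_def using assms by (intro sum.mono_neutral_left; auto)+

text \<open>On the span of \<open>e\<close> the assignment of \<open>b i\<close> to
  \<open>e i\<close> is dominated by the gauge of \<open>V\<close>, because \<open>eV\<close>,
  rescaled, says that the gauge of \<open>ell1_map e a\<close> is at least
  \<open>ell1_norm a\<close>. Symmetry of \<open>V\<close> then bounds the extension by 1 in modulus
  on \<open>V\<close>.\<close>

lemma ell1_functional:
  fixes e :: "nat \<Rightarrow> 'a::real_topological_vector"
  assumes V: "open V" "0 \<in> V" "convex V" "\<And>x. x \<in> V \<Longrightarrow> - x \<in> V"
    and eV: "\<And>a. a \<in> ell1_fin \<Longrightarrow> ell1_map e a \<in> V \<Longrightarrow> ell1_norm a \<le> 1"
    and b: "\<And>i. \<bar>b i\<bar> \<le> 1"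
  obtains \<phi> where "\<phi> \<in> topological_dual" "\<And>v. v \<in> V \<Longrightarrow> \<bar>\<phi> v\<bar> \<le> 1" "\<And>i. \<phi> (e i) = b i"
proof -
  \<comment> \<open>The graph of the prescribed functional on the span, used as the cone of
    constraints in \<open>Mazur_Orlicz\<close>. It is symmetric, so the constraints become
    equalities.\<close>
  define R where "R = {(ell1_map e a, \<Sum>i | a i \<noteq> 0. a i * b i) |a. a \<in> ell1_fin}"
  have RI: "(\<Sum>i\<in>S. a i *\<^sub>R e i, \<Sum>i\<in>S. a i * b i) \<in> R" if "finite S" "{i. a i \<noteq> 0} \<subseteq> S" for S a
  proof -
    have "a \<in> ell1_fin" using that finite_subset by (auto simp: ell1_fin_def)
    then show ?thesis unfolding R_def
      by (intro CollectI exI[of _ a]) (simp add: sum_ell1_support[OF that])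
  qed
  have RE: "\<exists>a S. finite S \<and> {i. a i \<noteq> 0} \<subseteq> S \<and> x = (\<Sum>i\<in>S. a i *\<^sub>R e i) \<and> t = (\<Sum>i\<in>S. a i * b i)"
    if "(x, t) \<in> R" for x t
    using that unfolding R_def ell1_map_def ell1_fin_def by blast
  obtain \<phi> where \<phi>: "linear \<phi>" "\<And>x. \<phi> x \<le> gauge_fun V x" "\<And>x t. (x, t) \<in> R \<Longrightarrow> t \<le> \<phi> x"
  proof (rule Mazur_Orlicz[OF sublinear_gauge_fun[OF V(1-3)], of R])
    show "(0, 0) \<in> R" using RI[of "{}" "\<lambda>_. 0"] by simp
  next
    fix x t y u assume "(x, t) \<in> R" "(y, u) \<in> R"
    then obtain a S a' S' where
      a: "finite S" "{i. a i \<noteq> 0} \<subseteq> S" "x = (\<Sum>i\<in>S. a i *\<^sub>R e i)" "t = (\<Sum>i\<in>S. a i * b i)" and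
      a': "finite S'" "{i. a' i \<noteq> 0} \<subseteq> S'" "y = (\<Sum>i\<in>S'. a' i *\<^sub>R e i)" "u = (\<Sum>i\<in>S'. a' i * b i)"
      using RE by meson
    have 1: "x = (\<Sum>i\<in>S \<union> S'. a i *\<^sub>R e i)" "t = (\<Sum>i\<in>S \<union> S'. a i * b i)"
      unfolding a using a a' by (intro sum.mono_neutral_left; auto)+
    have 2: "y = (\<Sum>i\<in>S \<union> S'. a' i *\<^sub>R e i)" "u = (\<Sum>i\<in>S \<union> S'. a' i * b i)"
      unfolding a' using a a' by (intro sum.mono_neutral_left; auto)+
    have "{i. a i + a' i \<noteq> 0} \<subseteq> {i. a i \<noteq> 0} \<union> {i. a' i \<noteq> 0}" by auto
    then have "(\<Sum>i\<in>S \<union> S'. (a i + a' i) *\<^sub>R e i, \<Sum>i\<in>S \<union> S'. (a i + a' i) * b i) \<in> R"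
      using a(1,2) a'(1,2) by (intro RI) blast+
    then show "(x + y, t + u) \<in> R" unfolding 1 2 by (simp add: algebra_simps sum.distrib)
  next
    fix x t c assume "(x, t) \<in> R"
    then obtain a S where a: "finite S" "{i. a i \<noteq> 0} \<subseteq> S" "x = (\<Sum>i\<in>S. a i *\<^sub>R e i)" "t = (\<Sum>i\<in>S. a i * b i)"
      using RE by meson
    have "(\<Sum>i\<in>S. (c * a i) *\<^sub>R e i, \<Sum>i\<in>S. (c * a i) * b i) \<in> R" using a by (intro RI) auto
    then show "(c *\<^sub>R x, c * t) \<in> R" unfolding a by (simp add: scaleR_sum_right sum_distrib_left mult.assoc)
  next
    fix x t assume "(x, t) \<in> R"
    then obtain a where a: "a \<in> ell1_fin" "x = ell1_map e a" "t = (\<Sum>i | a i \<noteq> 0. a i * b i)"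
      by (auto simp: R_def)
    have "t \<le> ell1_norm a" unfolding a ell1_norm_def
    proof (rule sum_mono)
      fix i
      have "a i * b i \<le> \<bar>a i\<bar> * \<bar>b i\<bar>" by (metis abs_ge_self abs_mult)
      also have "\<dots> \<le> \<bar>a i\<bar> * 1" using b by (intro mult_left_mono) auto
      finally show "a i * b i \<le> \<bar>a i\<bar>" by simp
    qed
    also have "ell1_norm a \<le> gauge_fun V x"
    proof (rule gauge_fun_ge[OF V(1,2)])
      fix r v assume r: "r > 0" "v \<in> V" "x = r *\<^sub>R v"
      define a' where "a' i = a i / r" for i
      have supp: "{i. a' i \<noteq> 0} = {i. a i \<noteq> 0}" using r by (auto simp: a'_def)
      have "ell1_map e a' = (1 / r) *\<^sub>R x"
        unfolding ell1_map_def supp a scaleR_sum_right by (simp add: a'_def)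
      then have "ell1_norm a' \<le> 1" using r a supp by (intro eV) (auto simp: ell1_fin_def)
      moreover have "ell1_norm a' = ell1_norm a / r"
        unfolding ell1_norm_def supp using r by (simp add: a'_def sum_divide_distrib)
      ultimately show "ell1_norm a \<le> r" using r by (simp add: field_simps)
    qed
    finally show "t \<le> gauge_fun V x" .
  qed blast
  have bd: "\<bar>\<phi> v\<bar> \<le> 1" if v: "v \<in> V" for v
  proof -
    have "\<phi> w \<le> 1" if "w \<in> V" for w
      using \<phi>(2)[of w] gauge_fun_le[of 1 w V] that by simp
    from this[OF v] this[OF V(4)[OF v]] show ?thesis using linear_neg[OF \<phi>(1), of v] by simp
  qed
  have "c * b i \<le> \<phi> (c *\<^sub>R e i)" for i c
  proof (rule \<phi>(3))
    have "{j. (if j = i then c else 0) \<noteq> 0} \<subseteq> {i}" by (auto split: if_splits)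
    from RI[OF _ this] show "(c *\<^sub>R e i, c * b i) \<in> R" by simp
  qed
  then have "\<phi> (e i) = b i" for i
    using linear_neg[OF \<phi>(1), of "e i"] by (metis antisym mult_1 mult_minus1 neg_le_iff_le scaleR_minus1_left scaleR_one)
  then show ?thesis using that topological_dualI[OF \<phi>(1) V(1,2) bd] bd by blast
qed

section \<open>Fixed points on finite-dimensional cubes\<close>

lemma compact_Pi_UNIV:
  fixes F :: "'i \<Rightarrow> 'b::topological_space set"
  assumes "\<And>i. compact (F i)"
  shows "compact (Pi UNIV F)"
proof -
  have "compactin (product_topology (\<lambda>i. euclidean) UNIV) (PiE UNIV F)"
    using assms by (simp add: compactin_PiE compactin_euclidean_iff)
  then show ?thesis by (simp add: euclidean_product_topology compactin_euclidean_iff PiE_UNIV_domain)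
qed

lemma tendsto_coordinatewise:
  fixes f :: "'b \<Rightarrow> 'i \<Rightarrow> 'c::topological_space"
  shows "(f \<longlongrightarrow> l) F \<longleftrightarrow> (\<forall>i. ((\<lambda>c. f c i) \<longlongrightarrow> l i) F)"
  using limitin_componentwise[of "\<lambda>_. euclidean" UNIV f l F]
  by (simp add: euclidean_product_topology)

text \<open>Brouwer's theorem in the library is stated for a type of fixed dimension, whereas \<open>n\<close> is arbitrary
  here; so it is derived again from the combinatorial lemma, inside the Hilbert cube, whose
  coordinates from \<open>n\<close> on are set to 0.\<close>

lemma brouwer_cube_nat:
  fixes G :: "(nat \<Rightarrow> real) \<Rightarrow> nat \<Rightarrow> real"
  assumes cont: "\<And>i. i < n \<Longrightarrow> continuous_on (Pi UNIV (\<lambda>_. {0..1})) (\<lambda>t. G t i)"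
    and cube: "\<And>t i. t \<in> Pi UNIV (\<lambda>_. {0..1}) \<Longrightarrow> i < n \<Longrightarrow> G t i \<in> {0..1}"
  obtains t where "t \<in> Pi UNIV (\<lambda>_. {0..1})" "\<And>i. i < n \<Longrightarrow> G t i = t i"
proof -
  define Q :: "(nat \<Rightarrow> real) set" where "Q = Pi UNIV (\<lambda>_. {0..1})"
  have Q: "compact Q" unfolding Q_def by (intro compact_Pi_UNIV) simp
  define pt where "pt p x = (\<lambda>i. if i < n then real (x i) / real p else 0)" for p :: nat and x :: "nat \<Rightarrow> nat"
  have ptQ: "pt p x \<in> Q" if "p > 0" "\<forall>i<n. x i \<le> p" for p x
    using that by (auto simp: Q_def pt_def)
  have GQ: "0 \<le> G y i \<and> G y i \<le> 1" if "y \<in> Q" "i < n" for y i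
    using cube[of y i] that by (simp add: Q_def)
  \<comment> \<open>Kuhn's labelling: away from the boundary, label 0 means that \<open>G\<close>
    does not decrease coordinate \<open>i\<close>. The hypotheses of \<open>kuhn_lemma\<close> force
    0 on the face \<open>x i = 0\<close> and 1 on the face \<open>x i = p\<close>.\<close>
  define label where "label p x i = (if x i = 0 \<or> x i < p \<and> pt p x i \<le> G (pt p x) i then 0 else 1::nat)"
    for p x i
  have lab0: "pt p x i \<le> G (pt p x) i" if "label p x i = 0" "p > 0" "\<forall>i<n. x i \<le> p" "i < n" for p x i
  proof (cases "x i = 0")
    case True
    then have "pt p x i = 0" by (simp add: pt_def)
    then show ?thesis using GQ[OF ptQ[OF that(2,3)] that(4)] by simp
  next
    case False
    then show ?thesis using that(1) unfolding label_def by (simp split: if_split_asm)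
  qed
  have lab1: "G (pt p x) i \<le> pt p x i" if "label p x i \<noteq> 0" "p > 0" "\<forall>i<n. x i \<le> p" "i < n" for p x i
  proof (cases "x i = p")
    case True
    then have "pt p x i = 1" using that(2,4) by (simp add: pt_def)
    then show ?thesis using GQ[OF ptQ[OF that(2,3)] that(4)] by simp
  next
    case False
    then have "x i < p" using that(3,4) le_neq_implies_less by blast
    moreover have "\<not> (x i = 0 \<or> x i < p \<and> pt p x i \<le> G (pt p x) i)"
      using that(1) by (rule contrapos_nn) (simp add: label_def)
    ultimately show ?thesis by (meson linear)
  qed
  have "\<exists>q. (\<forall>i<n. q i < p) \<and> (\<forall>i<n. \<exists>r s. (\<forall>j<n. q j \<le> r j \<and> r j \<le> q j + 1) \<and>
      (\<forall>j<n. q j \<le> s j \<and> s j \<le> q j + 1) \<and> label p r i = 0 \<and> label p s i \<noteq> 0)" if p: "p > 0" for p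
  proof -
    obtain q where q: "\<forall>i<n. q i < p"
       "\<forall>i<n. \<exists>r s. (\<forall>j<n. q j \<le> r j \<and> r j \<le> q j + 1) \<and> (\<forall>j<n. q j \<le> s j \<and> s j \<le> q j + 1)
          \<and> label p r i \<noteq> label p s i"
    proof (rule kuhn_lemma[of p n "label p"])
      show "\<forall>x. (\<forall>i<n. x i \<le> p) \<longrightarrow> (\<forall>i<n. label p x i = 0 \<or> label p x i = 1)"
        by (simp add: label_def)
      show "\<forall>x. (\<forall>i<n. x i \<le> p) \<longrightarrow> (\<forall>i<n. x i = 0 \<longrightarrow> label p x i = 0)"
        by (simp add: label_def)
      show "\<forall>x. (\<forall>i<n. x i \<le> p) \<longrightarrow> (\<forall>i<n. x i = p \<longrightarrow> label p x i = 1)"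
        using p by (simp add: label_def)
    qed (use p in simp_all)
    show ?thesis
    proof (rule exI[of _ q], intro conjI allI impI)
      fix i assume i: "i < n"
      then show "q i < p" using q(1) by blast
      from q(2) i obtain r s where rs: "\<forall>j<n. q j \<le> r j \<and> r j \<le> q j + 1" 
        "\<forall>j<n. q j \<le> s j \<and> s j \<le> q j + 1" "label p r i \<noteq> label p s i" by blast
      moreover have "label p x i = 0 \<or> label p x i = 1" for x by (simp add: label_def)
      ultimately show "\<exists>r s. (\<forall>j<n. q j \<le> r j \<and> r j \<le> q j + 1) \<and>
        (\<forall>j<n. q j \<le> s j \<and> s j \<le> q j + 1) \<and> label p r i = 0 \<and> label p s i \<noteq> 0"
        by (cases "label p r i = 0") metis+
    qed
  qed
  then have "\<forall>p. \<exists>q. (\<forall>i<n. q i < Suc p) \<and> (\<forall>i<n. \<exists>r s. (\<forall>j<n. q j \<le> r j \<and> r j \<le> q j + 1) \<and>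
      (\<forall>j<n. q j \<le> s j \<and> s j \<le> q j + 1) \<and> label (Suc p) r i = 0 \<and> label (Suc p) s i \<noteq> 0)"
    by blast
  then obtain q where q: "\<And>p i. i < n \<Longrightarrow> q p i < Suc p" and
    "\<forall>p. \<forall>i<n. \<exists>r s. (\<forall>j<n. q p j \<le> r j \<and> r j \<le> q p j + 1) \<and>
      (\<forall>j<n. q p j \<le> s j \<and> s j \<le> q p j + 1) \<and> label (Suc p) r i = 0 \<and> label (Suc p) s i \<noteq> 0"
    unfolding choice_iff by blast
  then obtain r s where
    r: "\<And>p i j. i < n \<Longrightarrow> j < n \<Longrightarrow> q p j \<le> r p i j \<and> r p i j \<le> q p j + 1" and
    s: "\<And>p i j. i < n \<Longrightarrow> j < n \<Longrightarrow> q p j \<le> s p i j \<and> s p i j \<le> q p j + 1" and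
    lr: "\<And>p i. i < n \<Longrightarrow> label (Suc p) (r p i) i = 0" and
    ls: "\<And>p i. i < n \<Longrightarrow> label (Suc p) (s p i) i \<noteq> 0"
    by metis
  have qQ: "pt (Suc p) (q p) \<in> Q" for p using q by (intro ptQ) (auto simp: less_imp_le)
  obtain t u where t: "t \<in> Q" and u: "strict_mono u" and lim: "(\<lambda>m. pt (Suc (u m)) (q (u m))) \<longlonglongrightarrow> t"
    using compact_imp_seq_compact[OF Q] qQ unfolding seq_compact_def comp_def
    by (elim allE[of _ "\<lambda>p. pt (Suc p) (q p)"]) auto
  have limi: "(\<lambda>m. pt (Suc (u m)) (q (u m)) i) \<longlonglongrightarrow> t i" for i
    using lim unfolding tendsto_coordinatewise by blast
  have inv: "(\<lambda>m. 1 / real (Suc (u m))) \<longlonglongrightarrow> 0"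
    using LIMSEQ_subseq_LIMSEQ[OF LIMSEQ_inverse_real_of_nat u] by (simp add: comp_def inverse_eq_divide)
  \<comment> \<open>The cells have side \<open>1 / Suc p\<close>, so all their corners share the
    limit \<open>t\<close> of the base points.\<close>
  have near: "(\<lambda>m. pt (Suc (u m)) (x (u m))) \<longlonglongrightarrow> t"
    if x: "\<And>p j. j < n \<Longrightarrow> q p j \<le> x p j \<and> x p j \<le> q p j + 1" for x
  proof -
    have "(\<lambda>m. pt (Suc (u m)) (x (u m)) j) \<longlonglongrightarrow> t j" for j
    proof (rule tendsto_sandwich[OF _ _ limi])
      show "(\<lambda>m. pt (Suc (u m)) (q (u m)) j + 1 / real (Suc (u m))) \<longlonglongrightarrow> t j"
        using tendsto_add[OF limi inv] by simp
      show "\<forall>\<^sub>F m in sequentially. pt (Suc (u m)) (q (u m)) j \<le> pt (Suc (u m)) (x (u m)) j"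
        using x by (intro always_eventually allI) (auto simp: pt_def intro!: divide_right_mono)
      show "\<forall>\<^sub>F m in sequentially. pt (Suc (u m)) (x (u m)) j
          \<le> pt (Suc (u m)) (q (u m)) j + 1 / real (Suc (u m))"
      proof (intro always_eventually allI)
        fix m
        have "real (x (u m) j) \<le> real (q (u m) j) + 1" if "j < n" using x[OF that, of "u m"] by linarith
        then show "pt (Suc (u m)) (x (u m)) j \<le> pt (Suc (u m)) (q (u m)) j + 1 / real (Suc (u m))"
          by (auto simp: pt_def simp flip: add_divide_distrib intro!: divide_right_mono)
      qed
    qed
    then show ?thesis by (simp add: tendsto_coordinatewise)
  qed
  have "G t i = t i" if i: "i < n" for i
  proof (rule antisym)
    have contG: "continuous_on Q (\<lambda>t. G t i)" using cont[OF i] by (simp add: Q_def)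
    have rQ: "pt (Suc p) (r p i) \<in> Q" and sQ: "pt (Suc p) (s p i) \<in> Q" 
      and rle: "\<forall>j<n. r p i j \<le> Suc p" and sle: "\<forall>j<n. s p i j \<le> Suc p" for p
    proof -
      show *: "\<forall>j<n. r p i j \<le> Suc p" "\<forall>j<n. s p i j \<le> Suc p"
        using r[OF i, of _ p] s[OF i, of _ p] q[of _ p] by (metis Suc_eq_plus1 Suc_leI order_trans)+
      show "pt (Suc p) (r p i) \<in> Q" "pt (Suc p) (s p i) \<in> Q" using * by (auto intro!: ptQ)
    qed
    have lims: "(\<lambda>m. pt (Suc (u m)) (s (u m) i)) \<longlonglongrightarrow> t" 
      and limr: "(\<lambda>m. pt (Suc (u m)) (r (u m) i)) \<longlonglongrightarrow> t"
      using r[OF i] s[OF i] by (intro near; blast)+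
    have coord: "(\<lambda>m. f m i) \<longlonglongrightarrow> t i" if "f \<longlonglongrightarrow> t" for f
      using that unfolding tendsto_coordinatewise by blast
    show "G t i \<le> t i"
    proof (rule LIMSEQ_le)
      show "(\<lambda>m. G (pt (Suc (u m)) (s (u m) i)) i) \<longlonglongrightarrow> G t i"
        using continuous_on_tendsto_compose[OF contG lims t] sQ by simp
      show "(\<lambda>m. pt (Suc (u m)) (s (u m) i) i) \<longlonglongrightarrow> t i" by (rule coord[OF lims])
      show "\<exists>N. \<forall>m\<ge>N. G (pt (Suc (u m)) (s (u m) i)) i \<le> pt (Suc (u m)) (s (u m) i) i"
        using lab1[OF ls[OF i]] sle i by blast
    qed
    show "t i \<le> G t i"
    proof (rule LIMSEQ_le)
      show "(\<lambda>m. G (pt (Suc (u m)) (r (u m) i)) i) \<longlonglongrightarrow> G t i"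
        using continuous_on_tendsto_compose[OF contG limr t] rQ by simp
      show "(\<lambda>m. pt (Suc (u m)) (r (u m) i) i) \<longlonglongrightarrow> t i" by (rule coord[OF limr])
      show "\<exists>N. \<forall>m\<ge>N. pt (Suc (u m)) (r (u m) i) i \<le> G (pt (Suc (u m)) (r (u m) i)) i"
        using lab0[OF lr[OF i]] rle i by blast
    qed
  qed
  then show ?thesis using that t by (auto simp: Q_def)
qed

section \<open>A dichotomy for ultrafilters and independent sequences\<close>

definition ultrafilter :: "'i set set \<Rightarrow> bool" where
  "ultrafilter U \<longleftrightarrow> {} \<notin> U \<and> (\<forall>A\<in>U. \<forall>B\<in>U. A \<inter> B \<in> U) \<and>
     (\<forall>A B. A \<in> U \<and> A \<subseteq> B \<longrightarrow> B \<in> U) \<and> (\<forall>A. A \<in> U \<or> - A \<in> U)"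

lemma ultrafilter_Inter:
  assumes "ultrafilter U" "finite \<F>" "\<F> \<subseteq> U"
  shows "\<Inter>\<F> \<in> U"
  using assms(2,3)
proof (induction \<F>)
  case empty
  then show ?case
    using assms(1) unfolding ultrafilter_def by (metis Compl_UNIV_eq Inter_empty)
next
  case (insert A \<F>)
  then show ?case using assms(1) by (simp add: ultrafilter_def)
qed

text \<open>A family maximal among those with the finite intersection property contains every set
  that meets all its finite intersections (\<open>mem\<close>). The closure axioms and the choice
  between \<open>A\<close> and \<open>- A\<close> follow from that.\<close>

lemma ultrafilter_exists:
  assumes fip: "\<And>\<G>. finite \<G> \<Longrightarrow> \<G> \<subseteq> \<F> \<Longrightarrow> \<Inter>\<G> \<noteq> {}"
  obtains U where "ultrafilter U" "\<F> \<subseteq> U"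
proof -
  define \<A> where "\<A> = {\<H>. \<F> \<subseteq> \<H> \<and> (\<forall>\<G>. finite \<G> \<and> \<G> \<subseteq> \<H> \<longrightarrow> \<Inter>\<G> \<noteq> {})}"
  have "\<exists>M\<in>\<A>. \<forall>X\<in>\<A>. M \<subseteq> X \<longrightarrow> X = M"
  proof (rule subset_Zorn_nonempty)
    show "\<A> \<noteq> {}" using fip by (auto simp: \<A>_def)
    fix \<C> assume ne: "\<C> \<noteq> {}" and ch: "subset.chain \<A> \<C>"
    then have sub: "\<C> \<subseteq> \<A>" by (simp add: subset.chain_def)
    have "\<Inter>\<G> \<noteq> {}" if G: "finite \<G>" "\<G> \<subseteq> \<Union>\<C>" for \<G>
    proof -
      obtain Y where "Y \<in> \<C>" "\<G> \<subseteq> Y"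
        using finite_subset_Union_chain[OF G ne ch] by metis
      then show ?thesis using sub G unfolding \<A>_def by blast
    qed
    then show "\<Union>\<C> \<in> \<A>"
      using sub ne unfolding \<A>_def by blast
  qed
  then obtain U where U: "U \<in> \<A>" and max: "\<And>X. X \<in> \<A> \<Longrightarrow> U \<subseteq> X \<Longrightarrow> X = U" by blast
  have fipU: "\<Inter>\<G> \<noteq> {}" if "finite \<G>" "\<G> \<subseteq> U" for \<G>
    using U that by (simp add: \<A>_def)
  have mem: "A \<in> U" if A: "\<And>\<G>. finite \<G> \<Longrightarrow> \<G> \<subseteq> U \<Longrightarrow> A \<inter> \<Inter>\<G> \<noteq> {}" for A
  proof -
    have "\<Inter>\<G> \<noteq> {}" if "finite \<G>" "\<G> \<subseteq> insert A U" for \<G>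
    proof -
      have "A \<inter> \<Inter>(\<G> - {A}) \<subseteq> \<Inter>\<G>" by blast
      moreover have "A \<inter> \<Inter>(\<G> - {A}) \<noteq> {}" using that by (intro A) auto
      ultimately show ?thesis by blast
    qed
    then have "insert A U \<in> \<A>" using U by (auto simp: \<A>_def)
    from max[OF this] show ?thesis by blast
  qed
  have "ultrafilter U"
    unfolding ultrafilter_def
  proof (intro conjI ballI allI impI)
    show "{} \<notin> U" using fipU[of "{{}}"] by auto
  next
    fix A B assume AB: "A \<in> U" "B \<in> U"
    show "A \<inter> B \<in> U"
    proof (rule mem)
      fix \<G> assume "finite \<G>" "\<G> \<subseteq> U"
      then show "A \<inter> B \<inter> \<Inter>\<G> \<noteq> {}"
        using fipU[of "insert A (insert B \<G>)"] AB by (auto simp: Int_assoc)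
    qed
  next
    fix A B assume AB: "A \<in> U \<and> A \<subseteq> B"
    show "B \<in> U"
    proof (rule mem)
      fix \<G> assume "finite \<G>" "\<G> \<subseteq> U"
      then show "B \<inter> \<Inter>\<G> \<noteq> {}" using fipU[of "insert A \<G>"] AB by auto
    qed
  next
    fix A show "A \<in> U \<or> - A \<in> U"
    proof (rule ccontr)
      assume "\<not> ?thesis"
      then obtain \<G> \<H> where G: "finite \<G>" "\<G> \<subseteq> U" "A \<inter> \<Inter>\<G> = {}"
        and H: "finite \<H>" "\<H> \<subseteq> U" "- A \<inter> \<Inter>\<H> = {}"
        using mem[of A] mem[of "- A"] by blast
      have "\<Inter>(\<G> \<union> \<H>) = {}" using G(3) H(3) by blast
      then show False using fipU[of "\<G> \<union> \<H>"] G H by simp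
    qed
  qed
  then show ?thesis using that U by (simp add: \<A>_def)
qed

text \<open>A Cantor--Bendixson argument: the closed set \<open>L\<close> left after deleting all open sets on which the
  first alternative holds has large oscillation along \<open>U\<close> in each relatively open part. If \<open>L\<close> is not
  empty, the levels \<open>r < s\<close> can be fixed on a part where the set \<open>J\<close> of admissible grid levels is
  smallest, and since \<open>U\<close> is an ultrafilter one index \<open>n l\<close> splits all \<open>2^l\<close> pieces of the
  \<open>l\<close>-th generation at once.\<close>

lemma ultrafilter_dichotomy:
  fixes K :: "(nat \<Rightarrow> real) set"
  assumes K: "compact K" and bnd: "\<And>k i. k \<in> K \<Longrightarrow> \<bar>k i\<bar> \<le> M"
    and U: "ultrafilter U"
  obtains
    (oscillation) "\<And>e. e > 0 \<Longrightarrow> \<exists>\<B>. countable \<B> \<and> \<B> \<subseteq> U \<and>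
        (\<forall>k\<in>K. \<exists>B\<in>\<B>. \<forall>i\<in>B. \<forall>j\<in>B. \<bar>k i - k j\<bar> \<le> e)"
  | (independent) n r s where "r < s"
      "\<And>P. \<exists>k\<in>K. \<forall>l::nat. if l \<in> P then s \<le> k (n l) else k (n l) \<le> r"
proof (cases "\<forall>e>0. \<exists>\<B>. countable \<B> \<and> \<B> \<subseteq> U \<and>
        (\<forall>k\<in>K. \<exists>B\<in>\<B>. \<forall>i\<in>B. \<forall>j\<in>B. \<bar>k i - k j\<bar> \<le> e)")
  case True
  then show ?thesis using oscillation by blast
next
  case False
  define good where "good e V \<longleftrightarrow> (\<exists>\<B>. countable \<B> \<and> \<B> \<subseteq> U \<and>
        (\<forall>k\<in>K \<inter> V. \<exists>B\<in>\<B>. \<forall>i\<in>B. \<forall>j\<in>B. \<bar>k i - k j\<bar> \<le> e))" for e V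
  from False obtain e where e: "e > 0" "\<not> good e UNIV"
    unfolding good_def by auto
  have Uup: "A \<in> U \<Longrightarrow> A \<subseteq> B \<Longrightarrow> B \<in> U" and Uint: "A \<in> U \<Longrightarrow> B \<in> U \<Longrightarrow> A \<inter> B \<in> U"
    and Uemp: "{} \<notin> U" and Ucompl: "A \<notin> U \<Longrightarrow> - A \<in> U" for A B
    using U unfolding ultrafilter_def by blast+
  obtain G :: "(nat \<Rightarrow> real) set set" where G: "countable G" "topological_basis G"
    using ex_countable_basis by blast
  \<comment> \<open>Only basic open sets are united, so the countable families of the good ones
    combine to a countable family for \<open>W\<close>.\<close>
  define W where "W = \<Union>{V\<in>G. good e V}"
  have openW: "open W"
    using G(2) by (auto simp: W_def topological_basis_def)
  have goodW: "good e W"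
  proof -
    define \<B> where "\<B> V = (SOME \<B>. countable \<B> \<and> \<B> \<subseteq> U \<and>
        (\<forall>k\<in>K \<inter> V. \<exists>B\<in>\<B>. \<forall>i\<in>B. \<forall>j\<in>B. \<bar>k i - k j\<bar> \<le> e))" for V
    have \<B>: "countable (\<B> V) \<and> \<B> V \<subseteq> U \<and>
        (\<forall>k\<in>K \<inter> V. \<exists>B\<in>\<B> V. \<forall>i\<in>B. \<forall>j\<in>B. \<bar>k i - k j\<bar> \<le> e)" if "good e V" for V
      using that unfolding \<B>_def good_def by (rule someI_ex)
    show ?thesis unfolding good_def
    proof (intro exI[of _ "\<Union>(\<B> ` {V\<in>G. good e V})"] conjI ballI)
      show "countable (\<Union>(\<B> ` {V\<in>G. good e V}))"
        using \<B> G(1) by (intro countable_UN) auto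
      show "\<Union>(\<B> ` {V\<in>G. good e V}) \<subseteq> U" using \<B> by blast
      fix k assume "k \<in> K \<inter> W"
      then obtain V where V: "V \<in> G" "good e V" "k \<in> K \<inter> V" by (auto simp: W_def)
      then obtain B where "B \<in> \<B> V" "\<forall>i\<in>B. \<forall>j\<in>B. \<bar>k i - k j\<bar> \<le> e"
        using \<B>[OF V(2)] by (elim conjE) (drule bspec[OF _ V(3)], elim bexE)
      then show "\<exists>B\<in>\<Union>(\<B> ` {V\<in>G. good e V}). \<forall>i\<in>B. \<forall>j\<in>B. \<bar>k i - k j\<bar> \<le> e"
        using V(1,2) by (intro bexI[of _ B]) auto
    qed
  qed
  define L where "L = K - W"
  have L: "compact L" unfolding L_def using K openW by (rule compact_diff)
  have Lne: "L \<noteq> {}"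
  proof
    assume "L = {}"
    then have "K \<inter> W = K \<inter> UNIV" by (auto simp: L_def)
    then show False using goodW e(2) by (simp add: good_def)
  qed
  \<comment> \<open>Otherwise adding \<open>B\<close> to the family for \<open>W\<close> makes a
    basic neighbourhood of a point of \<open>L\<close> good, and this neighbourhood would lie in
    \<open>W\<close>.\<close>
  have osc: "\<exists>k\<in>V \<inter> L. \<exists>i\<in>B. \<exists>j\<in>B. \<bar>k i - k j\<bar> > e"
    if V: "open V" "V \<inter> L \<noteq> {}" and B: "B \<in> U" for V B
  proof (rule ccontr)
    assume neg: "\<not> ?thesis"
    obtain \<B> where \<B>: "countable \<B>" "\<B> \<subseteq> U"
        "\<forall>k\<in>K \<inter> W. \<exists>B\<in>\<B>. \<forall>i\<in>B. \<forall>j\<in>B. \<bar>k i - k j\<bar> \<le> e"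
      using goodW by (auto simp: good_def)
    obtain k where k: "k \<in> V" "k \<in> L" using V by blast
    obtain N where N: "N \<in> G" "k \<in> N" "N \<subseteq> V"
      using topological_basisE[OF G(2) V(1) k(1)] by blast
    have "good e N" unfolding good_def
    proof (intro exI[of _ "insert B \<B>"] conjI ballI)
      show "countable (insert B \<B>)" "insert B \<B> \<subseteq> U" using \<B> B by auto
      fix k assume "k \<in> K \<inter> N"
      then show "\<exists>B\<in>insert B \<B>. \<forall>i\<in>B. \<forall>j\<in>B. \<bar>k i - k j\<bar> \<le> e"
        using \<B>(3) neg N(3) by (cases "k \<in> W") (force simp: L_def not_less)+
    qed
    then have "N \<subseteq> W" using N(1) by (auto simp: W_def)
    then show False using N(2) k(2) by (auto simp: L_def)
  qed
  define hi where "hi V c = {i. \<exists>k\<in>V \<inter> L. k i > c}" for V and c :: real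
  define lo where "lo V c = {i. \<exists>k\<in>V \<inter> L. k i < c}" for V and c :: real
  \<comment> \<open>A grid from \<open>- M\<close> with mesh \<open>e / 2\<close>: two steps span
    \<open>e\<close>, and the levels exceed \<open>M\<close> from index \<open>N\<close> on.\<close>
  define g where "g j = real j * (e/2) - M" for j :: nat
  obtain N where N: "real N * (e/2) > 2 * M"
    using e(1) reals_Archimedean3[of "e/2"] by fastforce
  define J where "J V = {j. j \<le> N \<and> hi V (g (Suc j)) \<in> U \<and> lo V (g j) \<in> U}" for V
  have finJ: "finite (J V)" for V by (simp add: J_def)
  have Lb: "\<bar>k i\<bar> \<le> M" if "k \<in> L" for k i using bnd that by (auto simp: L_def)
  have Jne: "J V \<noteq> {}" if V: "open V" "V \<inter> L \<noteq> {}" for V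
  proof
    assume J0: "J V = {}"
    have hiN: "hi V (g (Suc N)) \<notin> U"
    proof -
      have "g (Suc N) > M" using N e(1) by (simp add: g_def field_simps)
      then have "\<not> k i > g (Suc N)" if "k \<in> L" for k i
        using Lb[OF that, of i] by linarith
      then have "hi V (g (Suc N)) = {}"
        by (auto simp: hi_def)
      then show ?thesis using Uemp by simp
    qed
    \<comment> \<open>At the first \<open>j\<close> with \<open>hi V (g (Suc j))\<close> outside
      \<open>U\<close>, emptiness of \<open>J V\<close> bounds the values below by the grid level
      two steps lower, or by \<open>- M\<close> if \<open>j = 0\<close>. So on a set of
      \<open>U\<close> they lie in an interval of length at most \<open>e\<close>, against
      \<open>osc\<close>.\<close>
    define j where "j = (LEAST j. hi V (g (Suc j)) \<notin> U)"
    have j: "hi V (g (Suc j)) \<notin> U" and jN: "j \<le> N"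
      unfolding j_def using hiN by (rule LeastI, rule Least_le)
    obtain c where c: "\<And>k i. k \<in> V \<inter> L \<Longrightarrow> i \<in> - lo V c \<Longrightarrow> k i \<ge> c" "g (Suc j) \<le> c + e"
      "- lo V c \<in> U"
    proof (cases j)
      case 0
      have "\<not> k i < - M" if "k \<in> L" for k i
        using Lb[OF that, of i] by linarith
      then have "lo V (- M) = {}" by (auto simp: lo_def)
      then have "- lo V (- M) \<in> U" using Ucompl[of "lo V (- M)"] Uemp by simp
      then show ?thesis using e(1) 0 by (intro that[of "- M"]) (auto simp: g_def lo_def not_less)
    next
      case (Suc j')
      have "hi V (g (Suc j')) \<in> U" using not_less_Least[of j' "\<lambda>j. hi V (g (Suc j)) \<notin> U"] Suc
        by (auto simp: j_def)
      then have "lo V (g j') \<notin> U" using J0 jN Suc by (auto simp: J_def)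
      then show ?thesis using that[of "g j'"] Ucompl Suc
        by (auto simp: g_def lo_def not_less algebra_simps)
    qed
    define B where "B = - hi V (g (Suc j)) \<inter> - lo V c"
    have "B \<in> U" unfolding B_def using Uint[OF Ucompl[OF j] c(3)] .
    from osc[OF V this] obtain k i i' where k: "k \<in> V \<inter> L" "i \<in> B" "i' \<in> B" "\<bar>k i - k i'\<bar> > e"
      by blast
    have "c \<le> k i" "c \<le> k i'" using c(1) k by (auto simp: B_def)
    moreover have "k i \<le> g (Suc j)" "k i' \<le> g (Suc j)" using k by (auto simp: B_def hi_def not_less)
    ultimately show False using k(4) c(2) by linarith
  qed
  have "\<exists>V. open V \<and> V \<inter> L \<noteq> {}" using Lne by (intro exI[of _ UNIV]) auto
  then obtain V0 where V0: "open V0" "V0 \<inter> L \<noteq> {}"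
    and min: "\<And>V. open V \<Longrightarrow> V \<inter> L \<noteq> {} \<Longrightarrow> card (J V0) \<le> card (J V)"
    using ex_has_least_nat[of "\<lambda>V. open V \<and> V \<inter> L \<noteq> {}" _ "\<lambda>V. card (J V)"] by metis
  obtain j where j: "j \<in> J V0" using Jne V0 by blast
  define r s where "r = g j" and "s = g (Suc j)"
  have rs: "r < s" using e(1) by (simp add: r_def s_def g_def)
  have split: "hi V s \<in> U \<and> lo V r \<in> U" if V: "open V" "V \<inter> L \<noteq> {}" "V \<subseteq> V0" for V
  proof -
    have "hi V c \<subseteq> hi V0 c" "lo V c \<subseteq> lo V0 c" for c
      using V(3) by (auto simp: hi_def lo_def)
    then have "J V \<subseteq> J V0" unfolding J_def using Uup by blast
    then have "J V = J V0" using min[OF V(1,2)] finJ by (metis card_seteq)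
    then have "j \<in> J V" using j by simp
    then show ?thesis by (simp add: J_def r_def s_def)
  qed
  \<comment> \<open>Strict inequalities make the pieces relatively open, so that splitting can
    continue. They are weakened to closed conditions for the final compactness argument.\<close>
  define side where "side l P x \<longleftrightarrow> (if l \<in> P then s < x else x < r)" for l :: nat and P x
  have side_open: "open {k. side l P (k (n :: nat))}" for l P n
    unfolding side_def by (cases "l \<in> P") (auto intro!: open_Collect_less continuous_intros)
  have "\<exists>n. \<forall>m. \<forall>P. \<exists>k\<in>V0 \<inter> L. (\<forall>l<m. side l P (k (n l))) \<and> side m P (k (n m))"
  proof (rule dependent_wellorder_choice)
    fix m :: nat and n :: "nat \<Rightarrow> nat"
    assume IH: "\<And>y. y < m \<Longrightarrow> \<forall>P. \<exists>k\<in>V0 \<inter> L. (\<forall>l<y. side l P (k (n l))) \<and> side y P (k (n y))"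
    define T where "T P = V0 \<inter> (\<Inter>l\<in>{..<m}. {k. side l P (k (n l))})" for P
    have T: "open (T P)" "T P \<subseteq> V0" for P
      unfolding T_def using V0 by (auto intro!: open_Int open_INT side_open)
    have Tne: "T P \<inter> L \<noteq> {}" for P
    proof (cases m)
      case 0 then show ?thesis using V0 by (simp add: T_def)
    next
      case (Suc y)
      then obtain k where "k\<in>V0 \<inter> L" "\<forall>l<y. side l P (k (n l))" "side y P (k (n y))"
        using IH[of y] by blast
      then have "k \<in> T P \<inter> L" by (auto simp: T_def Suc less_Suc_eq)
      then show ?thesis by blast
    qed
    \<comment> \<open>Only the part of \<open>P\<close> below \<open>m\<close> matters, so the sets
      \<open>hi\<close> and \<open>lo\<close> of all pieces form a finite subfamily of
      \<open>U\<close> and have a common index \<open>i\<close>.\<close>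
    have TP: "T P = T (P \<inter> {..<m})" for P by (auto simp: T_def side_def)
    define \<S> where "\<S> = (\<lambda>P. hi (T P) s) ` Pow {..<m} \<union> (\<lambda>P. lo (T P) r) ` Pow {..<m}"
    have "\<Inter>\<S> \<in> U" using split[OF T(1) Tne T(2)]
      by (intro ultrafilter_Inter[OF U]) (auto simp: \<S>_def)
    then have "\<Inter>\<S> \<noteq> {}" using Uemp by (intro notI) simp
    then obtain i where i: "i \<in> \<Inter>\<S>" unfolding ex_in_conv[symmetric] by (elim exE)
    have ihl: "i \<in> hi (T P) s \<and> i \<in> lo (T P) r" for P
    proof -
      have "hi (T (P \<inter> {..<m})) s \<in> \<S>" "lo (T (P \<inter> {..<m})) r \<in> \<S>"
        unfolding \<S>_def by auto
      then show ?thesis using i TP[of P] by auto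
    qed
    show "\<exists>i. \<forall>P. \<exists>k\<in>V0 \<inter> L. (\<forall>l<m. side l P (k (n l))) \<and> side m P (k i)"
    proof (intro exI allI)
      fix P
      have "\<exists>k\<in>T P \<inter> L. side m P (k i)" using ihl[of P] by (auto simp: hi_def lo_def side_def)
      then show "\<exists>k\<in>V0 \<inter> L. (\<forall>l<m. side l P (k (n l))) \<and> side m P (k i)"
        by (auto simp: T_def)
    qed
  qed auto
  then obtain n where n: "\<And>m P. \<exists>k\<in>V0 \<inter> L. (\<forall>l<m. side l P (k (n l))) \<and> side m P (k (n m))"
    by blast
  have "\<exists>k\<in>K. \<forall>l. if l \<in> P then s \<le> k (n l) else k (n l) \<le> r" for P
  proof -
    define F where "F l = {k :: nat \<Rightarrow> real. if l \<in> P then s \<le> k (n l) else k (n l) \<le> r}" for l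
    have "L \<inter> (\<Inter>l\<in>UNIV. F l) \<noteq> {}"
    proof (rule compact_imp_fip_image[OF L])
      show "closed (F l)" for l
        unfolding F_def by (cases "l \<in> P") (auto intro!: closed_Collect_le continuous_intros)
      fix I :: "nat set" assume "finite I"
      then obtain m where m: "\<And>l. l \<in> I \<Longrightarrow> l < m" using finite_nat_bounded by blast
      obtain k where k: "k\<in>L" "\<forall>l<m. side l P (k (n l))" using n[of m P] by blast
      then have "k \<in> F l" if "l \<in> I" for l
        using m[OF that] by (force simp: F_def side_def)
      then show "L \<inter> (\<Inter>l\<in>I. F l) \<noteq> {}" using k(1) by blast
    qed
    then obtain k where "k \<in> L" "\<And>l. k \<in> F l" by blast
    then show ?thesis unfolding F_def L_def by blast
  qed
  with rs show ?thesis by (rule independent)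
qed

section \<open>Hulls of \<open>\<ell>\<^sub>1\<close>-sequences lack the weak-AFPP\<close>

text \<open>The image of the unit ball is relatively open and contains 0, so it contains the part of
  the range inside some \<open>V\<close>; injectivity carries this back to the coefficients.\<close>

lemma ell1_sequence_nhds_0:
  fixes e :: "nat \<Rightarrow> 'a::real_locally_convex"
  assumes "ell1_sequence e"
  obtains V where "open V" "0 \<in> V" "convex V" "\<And>x. x \<in> V \<Longrightarrow> - x \<in> V"
    "\<And>a. a \<in> ell1_fin \<Longrightarrow> ell1_map e a \<in> V \<Longrightarrow> ell1_norm a \<le> 1"
proof -
  define I where "I = ell1_map e ` ell1_fin"
  have h: "homeomorphic_map ell1_fin.mtopology (top_of_set I) (ell1_map e)"
    using assms by (simp add: ell1_sequence_def I_def)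
  have inj: "inj_on (ell1_map e) ell1_fin"
    using homeomorphic_imp_injective_map[OF h] by simp
  have z: "(\<lambda>_. 0) \<in> ell1_fin" by (simp add: ell1_fin_def)
  have "openin (top_of_set I) (ell1_map e ` ell1_fin.mball (\<lambda>_. 0) 1)"
    using homeomorphic_imp_open_map[OF h] ell1_fin.openin_mball unfolding open_map_def by blast
  then obtain T where T: "open T" "ell1_map e ` ell1_fin.mball (\<lambda>_. 0) 1 = I \<inter> T"
    by (auto simp: openin_open)
  have "ell1_map e (\<lambda>_. 0) = 0" by (simp add: ell1_map_def)
  moreover have "(\<lambda>_. 0) \<in> ell1_fin.mball (\<lambda>_. 0) 1" using z by simp
  ultimately have "0 \<in> T" using T(2) by (metis IntD2 imageI)
  then obtain V where V: "open V" "0 \<in> V" "V \<subseteq> T" "convex V" "\<And>x. x \<in> V \<Longrightarrow> - x \<in> V"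
    using symmetric_convex_nhds_0 T(1) by metis
  show ?thesis
  proof (rule that[OF V(1,2,4,5)])
    fix a assume a: "a \<in> ell1_fin" "ell1_map e a \<in> V"
    then have "ell1_map e a \<in> ell1_map e ` ell1_fin.mball (\<lambda>_. 0) 1"
      using T(2) V(3) by (auto simp: I_def)
    then have "a \<in> ell1_fin.mball (\<lambda>_. 0) 1" using inj a(1)
      by (metis (no_types, lifting) ell1_fin.mball_subset_mspace inj_on_image_mem_iff)
    then have "ell1_dist (\<lambda>_. 0) a < 1" by simp
    then show "ell1_norm a \<le> 1" by (simp add: ell1_dist_def ell1_norm_def)
  qed
qed

lemma convex_closure_tvs:
  fixes S :: "'a::real_topological_vector set"
  assumes "convex S"
  shows "convex (closure S)"
proof (rule convexI)
  fix x y and u v :: real assume xy: "x \<in> closure S" "y \<in> closure S" and uv: "u \<ge> 0" "v \<ge> 0" "u + v = 1"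
  have 1: "u *\<^sub>R a + v *\<^sub>R b \<in> closure S" if "a \<in> S" "b \<in> closure S" for a b
  proof -
    have "(\<lambda>b. u *\<^sub>R a + v *\<^sub>R b) ` closure S \<subseteq> closure S"
    proof (rule image_closure_subset)
      show "(\<lambda>b. u *\<^sub>R a + v *\<^sub>R b) ` S \<subseteq> closure S"
        using convexD[OF assms that(1) _ uv] closure_subset by blast
    qed (auto intro!: continuous_intros)
    then show ?thesis using that by blast
  qed
  have "(\<lambda>a. u *\<^sub>R a + v *\<^sub>R y) ` closure S \<subseteq> closure S"
    using 1 xy by (intro image_closure_subset) (auto intro!: continuous_intros)
  then show "u *\<^sub>R x + v *\<^sub>R y \<in> closure S" using xy by blast
qed

text \<open>Reduces inequalities between functionals on a closed convex hull to a check at the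
  generating points.\<close>

lemma linear_le_closed_convex_hull:
  fixes \<phi> :: "'a::real_topological_vector \<Rightarrow> real"
  assumes "linear \<phi>" "continuous_on UNIV \<phi>" "\<And>i. i \<in> A \<Longrightarrow> \<phi> i \<le> c"
    and x: "x \<in> closure (convex hull A)"
  shows "\<phi> x \<le> c"
proof -
  have "convex {x. \<phi> x \<le> c}"
    using convex_linear_vimage[OF assms(1) convex_real_interval(2)[of c]] by (simp add: vimage_def)
  then have "convex hull A \<subseteq> {x. \<phi> x \<le> c}" using assms(3) by (intro hull_minimal) auto
  moreover have "closed {x. \<phi> x \<le> c}" using assms(2) by (intro closed_Collect_le) auto
  ultimately have "closure (convex hull A) \<subseteq> {x. \<phi> x \<le> c}" by (rule closure_minimal)
  then show ?thesis using x by blast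
qed

text \<open>The lower \<open>\<ell>\<^sub>1\<close>-estimate from
  \<open>ell1_sequence_nhds_0\<close>, kept as one fixed neighbourhood \<open>V\<close>. It supplies
  functionals with arbitrary 0-1 values on \<open>e\<close>, all bounded by 1 on this
  \<open>V\<close>.\<close>

locale ell1_hull =
  fixes e :: "nat \<Rightarrow> 'a::real_topological_vector" and V :: "'a set"
  assumes V: "open V" "0 \<in> V" "convex V" "\<And>x. x \<in> V \<Longrightarrow> - x \<in> V"
    and eV: "\<And>a. a \<in> ell1_fin \<Longrightarrow> ell1_map e a \<in> V \<Longrightarrow> ell1_norm a \<le> 1"
begin

definition D where "D = closure (convex hull (range e))"

lemma convex_D: "convex D"
  by (simp add: D_def convex_closure_tvs)

lemma hull_sub_D: "convex hull (range e) \<subseteq> D"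
  by (simp add: D_def closure_subset)

lemma functional:
  obtains \<phi> where "\<phi> \<in> topological_dual" "\<And>v. v \<in> V \<Longrightarrow> \<bar>\<phi> v\<bar> \<le> 1"
    "\<And>i. \<phi> (e i) = (if i \<in> E then 1 else 0)"
proof (rule ell1_functional[of V e "\<lambda>i. if i \<in> E then 1 else 0"])
  show "open V" "0 \<in> V" "convex V" by (rule V)+
  show "- x \<in> V" if "x \<in> V" for x using that by (rule V(4))
  show "ell1_norm a \<le> 1" if "a \<in> ell1_fin" "ell1_map e a \<in> V" for a using that by (rule eV)
  show "\<bar>if i \<in> E then 1 else 0\<bar> \<le> (1::real)" for i by simp
qed (rule that)

text \<open>Extends the mass of the first \<open>n + 1\<close> coordinates to the whole closed hull.
  The common bound on \<open>V\<close> makes the \<open>F n\<close> equicontinuous.\<close>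

definition F where "F n = (SOME \<phi>. \<phi> \<in> topological_dual \<and> (\<forall>v\<in>V. \<bar>\<phi> v\<bar> \<le> 1) \<and>
    (\<forall>i. \<phi> (e i) = (if i \<le> n then 1 else 0)))" for n :: nat

lemma F: "F n \<in> topological_dual" "v \<in> V \<Longrightarrow> \<bar>F n v\<bar> \<le> 1" "F n (e i) = (if i \<le> n then 1 else 0)"
proof -
  have "\<exists>\<phi>. \<phi> \<in> topological_dual \<and> (\<forall>v\<in>V. \<bar>\<phi> v\<bar> \<le> 1) \<and> (\<forall>i. \<phi> (e i) = (if i \<le> n then 1 else 0))"
    using functional[of "{..n}"] by (metis atMost_iff)
  from someI_ex[OF this, folded F_def]
  show "F n \<in> topological_dual" "v \<in> V \<Longrightarrow> \<bar>F n v\<bar> \<le> 1" "F n (e i) = (if i \<le> n then 1 else 0)" by auto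
qed

lemma F_lin: "linear (F n)" and F_cont: "continuous_on UNIV (F n)"
  using F(1)[of n] by (auto simp: topological_dual_def)

lemma F_mono:
  assumes "x \<in> D" "n \<le> m"
  shows "F n x \<le> F m x"
proof -
  have "F n x - F m x \<le> 0"
  proof (rule linear_le_closed_convex_hull[of "\<lambda>x. F n x - F m x"])
    show "x \<in> closure (convex hull (range e))" using assms by (simp add: D_def)
  qed (use assms in \<open>auto simp: F(3) intro!: linear_compose_sub F_lin continuous_intros F_cont\<close>)
  then show ?thesis by simp
qed

text \<open>By equicontinuity a point \<open>y\<close> of the hull with
  \<open>8 *\<^sub>R (x - y) \<in> V\<close> has every \<open>F n y\<close> within 1/8 of
  \<open>F n x\<close>, and \<open>F n y = 1\<close> for large \<open>n\<close>.\<close>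

lemma F_large:
  assumes "x \<in> D"
  obtains n where "F n x > 3 / 4"
proof -
  have "open {y. 8 *\<^sub>R (x - y) \<in> V}"
    by (intro open_vimage[OF V(1), unfolded vimage_def] continuous_intros)
  moreover have "x \<in> {y. 8 *\<^sub>R (x - y) \<in> V}" using V(2) by simp
  ultimately obtain y where y: "y \<in> convex hull (range e)" "8 *\<^sub>R (x - y) \<in> V"
    using assms unfolding D_def closure_iff_nhds_not_empty by blast
  define T where "T = {y. \<exists>N. \<forall>n\<ge>N. F n y = 1}"
  have "convex T"
  proof (rule convexI)
    fix x y and u v :: real assume xy: "x \<in> T" "y \<in> T" and uv: "u + v = 1"
    obtain N M where "\<forall>n\<ge>N. F n x = 1" "\<forall>n\<ge>M. F n y = 1" using xy by (auto simp: T_def)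
    then have "\<forall>n\<ge>max N M. F n (u *\<^sub>R x + v *\<^sub>R y) = 1"
      using uv by (simp add: linear_add[OF F_lin] linear_scale[OF F_lin])
    then show "u *\<^sub>R x + v *\<^sub>R y \<in> T" unfolding T_def by blast
  qed
  moreover have "range e \<subseteq> T" by (auto simp: T_def F(3))
  ultimately have "y \<in> T" using y(1) hull_minimal by blast
  then obtain n where n: "F n y = 1" by (auto simp: T_def)
  have "\<bar>8 * (F n x - F n y)\<bar> \<le> 1"
    using F(2)[OF y(2), of n] by (simp only: linear_scale[OF F_lin] linear_diff[OF F_lin] real_scaleR_def)
  then have "F n x > 3 / 4" using n by (simp add: abs_le_iff)
  then show ?thesis by (rule that)
qed

text \<open>The map \<open>f\<close> shifts the distribution function \<open>n \<mapsto> F n x\<close> by one step and applies \<open>clamp_fun\<close>, for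
  which 0 attracts all of \<open>[0, 1/4]\<close>: if \<open>F n x\<close> and \<open>F n (f x)\<close> were close for all \<open>n\<close>, then \<open>F n x\<close>
  would stay small, but it tends to 1. Since \<open>clamp_fun\<close> equals 1 on \<open>[3/4, 1]\<close>, the sum in \<open>f\<close> is
  locally finite; where the support of \<open>g\<close> is infinite, \<open>f\<close> has a junk value.\<close>

definition clamp_fun :: "real \<Rightarrow> real" where "clamp_fun t = max 0 (min 1 (2 * t - 1 / 2))"

text \<open>The point masses of the sharpened distribution; their sums telescope.\<close>

definition g :: "nat \<Rightarrow> 'a \<Rightarrow> real" where
  "g n x = (if n = 0 then clamp_fun (F 0 x) else clamp_fun (F n x) - clamp_fun (F (n - 1) x))"

definition f :: "'a \<Rightarrow> 'a" where "f x = ell1_map (\<lambda>n. e (Suc n)) (\<lambda>n. g n x)"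

lemma sum_g: "(\<Sum>n\<le>N. g n x) = clamp_fun (F N x)"
  by (induction N) (simp_all add: g_def)

lemma g_nonneg: "x \<in> D \<Longrightarrow> g n x \<ge> 0"
  using F_mono[of x "n - 1" n] by (auto simp: g_def clamp_fun_def)

lemma g_vanish:
  assumes "x \<in> D" "F N x > 3 / 4" "N < n"
  shows "g n x = 0"
proof -
  have "F N x \<le> F n x" "F N x \<le> F (n - 1) x" using assms by (auto intro!: F_mono)
  then show ?thesis using assms by (simp add: g_def clamp_fun_def)
qed

lemma g_vanish_low: "x \<in> D \<Longrightarrow> F n x \<le> 1 / 4 \<Longrightarrow> g n x = 0"
  using F_mono[of x "n - 1" n] by (auto simp: g_def clamp_fun_def)

lemma f_eq: "x \<in> D \<Longrightarrow> F N x > 3 / 4 \<Longrightarrow> f x = (\<Sum>n\<le>N. g n x *\<^sub>R e (Suc n))"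
  unfolding f_def ell1_map_def using g_vanish[of x N] by (intro sum.mono_neutral_left) (auto simp flip: not_less)

lemma f_in_D: "x \<in> D \<Longrightarrow> f x \<in> D"
proof -
  assume x: "x \<in> D"
  obtain N where N: "F N x > 3 / 4" using F_large[OF x] .
  have "(\<Sum>n\<le>N. g n x *\<^sub>R e (Suc n)) \<in> convex hull (range e)"
  proof (rule convex_sum)
    show "(\<Sum>n\<le>N. g n x) = 1" using N by (simp add: sum_g clamp_fun_def)
  qed (use g_nonneg[OF x] in \<open>auto intro: hull_inc\<close>)
  then show ?thesis using f_eq[OF x N] hull_sub_D by auto
qed

text \<open>The inequality \<open>F N x > 3 / 4\<close> persists near \<open>x\<close>, where
  \<open>f\<close> therefore agrees with one fixed finite sum of continuous terms.\<close>

lemma f_cont: "continuous_on D f"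
  unfolding continuous_on_def
proof
  fix x assume x: "x \<in> D"
  obtain N where N: "F N x > 3 / 4" using F_large[OF x] .
  define h where "h y = (\<Sum>n\<le>N. g n y *\<^sub>R e (Suc n))" for y
  have "continuous_on UNIV (clamp_fun \<circ> F n)" for n
    unfolding clamp_fun_def comp_def by (intro continuous_intros F_cont)
  then have "continuous_on UNIV (g n)" for n
    unfolding g_def comp_def by (cases "n = 0") (auto intro!: continuous_intros)
  then have "continuous_on UNIV h"
    unfolding h_def by (intro continuous_intros)
  then have "continuous_on D h" using continuous_on_subset by blast
  then have h: "(h \<longlongrightarrow> h x) (at x within D)" using x by (simp add: continuous_on_def)
  have "(F N \<longlongrightarrow> F N x) (at x within D)"
    using F_cont[of N] continuous_on_subset[of UNIV "F N" D] x by (simp add: continuous_on_def)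
  then have "\<forall>\<^sub>F y in at x within D. F N y > 3 / 4" using N order_tendstoD(1) by blast
  moreover have "\<forall>\<^sub>F y in at x within D. y \<in> D" by (simp add: eventually_at_filter)
  ultimately have "\<forall>\<^sub>F y in at x within D. h y = f y"
    by eventually_elim (simp add: f_eq h_def)
  then show "(f \<longlongrightarrow> f x) (at x within D)"
    using h unfolding f_eq[OF x N] h_def[of x, symmetric] by (rule tendsto_cong[THEN iffD1])
qed

lemma functional_f:
  assumes "linear \<phi>" "x \<in> D" "F N x > 3 / 4"
  shows "\<phi> (f x) = (\<Sum>n\<le>N. g n x * \<phi> (e (Suc n)))"
  unfolding f_eq[OF assms(2,3)] by (simp add: linear_sum[OF assms(1)] linear_scale[OF assms(1)])

text \<open>The mass \<open>g n x\<close> sits at the shifted index \<open>Suc n\<close>, so index 0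
  carries nothing and the masses up to \<open>m\<close> telescope. Taking \<open>N\<close> as a
  maximum makes the finite sum reach \<open>m\<close>.\<close>

lemma F_f_Suc:
  assumes x: "x \<in> D"
  shows "F 0 (f x) = 0" "F (Suc m) (f x) = clamp_fun (F m x)"
proof -
  obtain N0 where N0: "F N0 x > 3 / 4" using F_large[OF x] .
  define N where "N = max m N0"
  have N: "F N x > 3 / 4" using N0 F_mono[OF x, of N0 N] by (simp add: N_def)
  show "F 0 (f x) = 0" by (simp add: functional_f[OF F_lin x N] F(3))
  have "F (Suc m) (f x) = (\<Sum>n\<le>N. if n \<le> m then g n x else 0)"
    unfolding functional_f[OF F_lin x N] by (intro sum.cong) (auto simp: F(3))
  also have "\<dots> = (\<Sum>n\<le>m. g n x)"
    by (intro sum.mono_neutral_cong_right) (auto simp: N_def)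
  finally show "F (Suc m) (f x) = clamp_fun (F m x)" by (simp add: sum_g)
qed

text \<open>A gliding hump: \<open>E\<close> is a union of blocks \<open>(m k, n (m k)]\<close> such that \<open>x (J (m k))\<close> has mass at
  least 1/8 in the \<open>k\<close>-th block, while its image under \<open>f\<close> lives between this block and the next.\<close>

lemma no_weak_approximate_fixed_points:
  assumes xD: "range x \<subseteq> D"
  shows "\<not> (\<forall>\<phi>\<in>topological_dual. (\<lambda>n. \<phi> (x n - f (x n))) \<longlonglongrightarrow> 0)"
proof
  assume conv: "\<forall>\<phi>\<in>topological_dual. (\<lambda>n. \<phi> (x n - f (x n))) \<longlonglongrightarrow> 0"
  have xj: "x j \<in> D" for j using xD by blast
  \<comment> \<open>No mass stays at bounded indices: once \<open>F M (x j) < 1 / 8\<close>,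
    clamping makes \<open>F (Suc M) (f (x j))\<close> vanish, and weak convergence passes the bound
    on to \<open>F (Suc M) (x j)\<close>.\<close>
  have small: "\<forall>\<^sub>F j in sequentially. F M (x j) < 1 / 8" for M
  proof (induction M)
    case 0
    have "\<forall>\<^sub>F j in sequentially. F 0 (x j - f (x j)) < 1 / 8"
      using conv F(1) by (intro order_tendstoD(2)[of _ 0]) auto
    then show ?case by (simp add: linear_diff[OF F_lin] F_f_Suc[OF xj])
  next
    case (Suc M)
    have "\<forall>\<^sub>F j in sequentially. F (Suc M) (x j - f (x j)) < 1 / 8"
      using conv F(1) by (intro order_tendstoD(2)[of _ 0]) auto
    with Suc show ?case
    proof eventually_elim
      case (elim j)
      have "clamp_fun (F M (x j)) = 0" using elim(1) by (simp add: clamp_fun_def)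
      then show ?case using elim(2) by (simp add: linear_diff[OF F_lin] F_f_Suc[OF xj])
    qed
  qed
  \<comment> \<open>Here \<open>n\<close> is the first index where the distribution function exceeds
    1/4. Hence \<open>x j\<close> has mass above 1/8 on the indices after \<open>M\<close> up to
    \<open>n\<close>, whereas its \<open>g\<close> is supported on those from \<open>n\<close> to
    \<open>N\<close>.\<close>
  have "\<exists>j n N. M < n \<and> n \<le> N \<and> M \<le> j \<and> F M (x j) < 1 / 8 \<and> F n (x j) > 1 / 4 \<and>
      (\<forall>i<n. F i (x j) \<le> 1 / 4) \<and> F N (x j) > 3 / 4" for M
  proof -
    obtain j where j: "M \<le> j" "F M (x j) < 1 / 8"
      using small[of M] unfolding eventually_sequentially by (metis nle_le)
    obtain N where N: "F N (x j) > 3 / 4" using F_large[OF xj] .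
    define n where "n = (LEAST n. F n (x j) > 1 / 4)"
    have n: "F n (x j) > 1 / 4" unfolding n_def
      by (rule LeastI[of "\<lambda>n. F n (x j) > 1 / 4" N]) (use N in simp)
    have least: "F i (x j) \<le> 1 / 4" if "i < n" for i
      using not_less_Least[of i "\<lambda>n. F n (x j) > 1 / 4"] that by (simp add: n_def)
    have "M < n"
    proof (rule ccontr)
      assume "\<not> M < n"
      then have "F n (x j) \<le> F M (x j)" by (intro F_mono xj) simp
      then show False using n j(2) by simp
    qed
    moreover have "F (max n N) (x j) > 3 / 4" using N F_mono[OF xj, of N "max n N" j] by simp
    ultimately show ?thesis using j n least
      by (intro exI[of _ j] exI[of _ n] exI[of _ "max n N"]) auto
  qed
  then obtain J n N where J: "\<And>M. M < n M \<and> n M \<le> N M \<and> M \<le> J M \<and> F M (x (J M)) < 1 / 8 \<and>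
      F (n M) (x (J M)) > 1 / 4 \<and>
      (\<forall>i<n M. F i (x (J M)) \<le> 1 / 4) \<and> F (N M) (x (J M)) > 3 / 4"
    by metis
  \<comment> \<open>The next block starts at \<open>Suc (N (m k))\<close> and is open on the left,
    so it misses the shifted support of the image, which ends at that very index.\<close>
  define m where "m k = ((\<lambda>i. Suc (N i)) ^^ k) 0" for k
  have mSuc: "m (Suc k) = Suc (N (m k))" for k by (simp add: m_def)
  have "m k < m (Suc k)" for k using J[of "m k"] by (simp add: mSuc)
  then have "strict_mono m" by (simp add: strict_mono_Suc_iff)
  define E where "E = (\<Union>k. {m k<..n (m k)})"
  obtain \<phi> where \<phi>: "\<phi> \<in> topological_dual" "\<And>i. \<phi> (e i) = (if i \<in> E then 1 else 0)"
    using functional[of E] by metis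
  have lin: "linear \<phi>" and cont: "continuous_on UNIV \<phi>" using \<phi>(1) by (auto simp: topological_dual_def)
  have "\<forall>\<^sub>F j in sequentially. \<phi> (x j - f (x j)) < 1 / 8"
    using conv \<phi>(1) by (intro order_tendstoD(2)[of _ 0]) auto
  then obtain j0 where j0: "\<And>j. j \<ge> j0 \<Longrightarrow> \<phi> (x j - f (x j)) < 1 / 8"
    unfolding eventually_sequentially by blast
  define M where "M = m j0"
  define y where "y = x (J M)"
  have yD: "y \<in> D" by (simp add: y_def xj)
  have "j0 \<le> M" unfolding M_def using \<open>strict_mono m\<close> by (rule strict_mono_imp_increasing)
  then have "j0 \<le> J M" using J[of M] by linarith
  then have 1: "\<phi> y - \<phi> (f y) < 1 / 8" using j0 by (simp add: y_def linear_diff[OF lin])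
  have notE: "i \<notin> E" if i: "n M < i" "i \<le> Suc (N M)" for i
  proof
    assume "i \<in> E"
    then obtain k where k: "m k < i" "i \<le> n (m k)" by (auto simp: E_def)
    show False
    proof (cases "k \<le> j0")
      case True
      have "n (m k) \<le> n M"
      proof (cases "k = j0")
        case False
        then have "m (Suc k) \<le> m j0" using True \<open>strict_mono m\<close> by (simp add: strict_mono_less_eq)
        then show ?thesis using J[of "m k"] J[of M] by (simp add: mSuc M_def)
      qed (simp add: M_def)
      then show ?thesis using k i by simp
    next
      case False
      then have "m (Suc j0) \<le> m k" using \<open>strict_mono m\<close> by (simp add: strict_mono_less_eq)
      then show ?thesis using k i by (simp add: mSuc M_def)
    qed
  qed
  have JM: "M < n M" "F M y < 1 / 8" "F (n M) y > 1 / 4"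
    "\<And>i. i < n M \<Longrightarrow> F i y \<le> 1 / 4" "F (N M) y > 3 / 4"
    using J[of M] by (auto simp: y_def)
  have "\<phi> (f y) = 0"
  proof -
    have "g i y * \<phi> (e (Suc i)) = 0" if "i \<le> N M" for i
    proof (cases "i < n M")
      case True
      then show ?thesis using g_vanish_low[OF yD JM(4)] by simp
    next
      case False
      then have "Suc i \<notin> E" using that by (intro notE) auto
      then show ?thesis by (simp add: \<phi>(2))
    qed
    then show ?thesis unfolding functional_f[OF lin yD JM(5)] by (intro sum.neutral) auto
  qed
  \<comment> \<open>On \<open>e\<close> the functional \<open>F (n M) - F M\<close> is the indicator
    of one block of \<open>E\<close>, hence at most \<open>\<phi>\<close>. This makes
    \<open>\<phi> y\<close> larger than 1/8.\<close>
  moreover have "F (n M) y - F M y - \<phi> y \<le> 0"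
  proof (rule linear_le_closed_convex_hull[of "\<lambda>y. F (n M) y - F M y - \<phi> y"])
    show "linear (\<lambda>y. F (n M) y - F M y - \<phi> y)" by (intro linear_compose_sub F_lin lin)
    show "continuous_on UNIV (\<lambda>y. F (n M) y - F M y - \<phi> y)" by (intro continuous_intros F_cont cont)
    show "y \<in> closure (convex hull (range e))" using yD by (simp add: D_def)
    fix v assume "v \<in> range e"
    then obtain i where i: "v = e i" by blast
    show "F (n M) v - F M v - \<phi> v \<le> 0"
    proof (cases "M < i \<and> i \<le> n M")
      case True
      then have "i \<in> E" unfolding E_def M_def by auto
      then show ?thesis by (simp add: i F(3) \<phi>(2))
    next
      case False
      then show ?thesis using JM(1) by (auto simp: i F(3) \<phi>(2))
    qed
  qed
  ultimately show False using 1 JM(2,3) by linarith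
qed

lemma not_weak_AFPP_D: "\<not> weak_AFPP D"
  using f_cont f_in_D no_weak_approximate_fixed_points unfolding weak_AFPP_def by blast

end

lemma ell1_sequence_imp_not_weak_AFPP:
  fixes C :: "'a::real_locally_convex set"
  assumes "closed C" "convex C" "range e \<subseteq> C" "ell1_sequence e"
  obtains D where "D \<noteq> {}" "closed D" "convex D" "D \<subseteq> C" "\<not> weak_AFPP D"
proof -
  obtain V where "open V" "0 \<in> V" "convex V" "\<And>x. x \<in> V \<Longrightarrow> - x \<in> V"
    "\<And>a. a \<in> ell1_fin \<Longrightarrow> ell1_map e a \<in> V \<Longrightarrow> ell1_norm a \<le> 1"
    using ell1_sequence_nhds_0[OF assms(4)] by metis
  then interpret ell1_hull e V by unfold_locales auto
  have "D \<subseteq> C" unfolding D_def using assms(1-3) by (intro closure_minimal hull_minimal)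
  moreover have "D \<noteq> {}" using hull_sub_D hull_subset[of "range e" convex] by blast
  moreover have "closed D" by (simp add: D_def)
  ultimately show ?thesis using convex_D not_weak_AFPP_D that[of D] by simp
qed

section \<open>Weak approximate fixed points along a countable set\<close>

lemma continuous_on_eval: "continuous_on A (\<lambda>k. k i)"
  by (rule continuous_on_product_then_coordinatewise) (rule continuous_on_id)

lemma continuous_on_eval2: "continuous_on A (\<lambda>k. k i j)"
  by (rule continuous_on_product_then_coordinatewise) (rule continuous_on_eval)

lemma tvs_bounded_absorbed:
  assumes "tvs_bounded C" "open V" "0 \<in> V"
  obtains t where "t > 0" "\<And>x. x \<in> C \<Longrightarrow> (1 / t) *\<^sub>R x \<in> V"
proof -
  obtain s where s: "s > 0" "\<And>t. t > s \<Longrightarrow> C \<subseteq> (\<lambda>x. t *\<^sub>R x) ` V"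
    using assms unfolding tvs_bounded_def by blast
  have "(1 / (s + 1)) *\<^sub>R x \<in> V" if x: "x \<in> C" for x
  proof -
    obtain v where "v \<in> V" "x = (s + 1) *\<^sub>R v" using s(2)[of "s + 1"] x by auto
    then show ?thesis using s(1) by simp
  qed
  then show ?thesis using s(1) that[of "s + 1"] by simp
qed

lemma topological_dual_scale:
  "\<phi> \<in> topological_dual \<Longrightarrow> (\<lambda>x. c * \<phi> x) \<in> topological_dual"
  unfolding topological_dual_def
  by (auto intro!: continuous_intros linear_compose_scale_right[where c = c and f = \<phi>, simplified])

lemma tvs_bounded_dual:
  assumes "tvs_bounded C" "\<phi> \<in> topological_dual"
  obtains B where "\<And>x. x \<in> C \<Longrightarrow> \<bar>\<phi> x\<bar> \<le> B"
proof -
  have lin: "linear \<phi>" and cont: "continuous_on UNIV \<phi>" using assms by (auto simp: topological_dual_def)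
  have "open {x. \<bar>\<phi> x\<bar> < 1}" by (intro open_Collect_less continuous_intros cont)
  then obtain t where t: "t > 0" "\<And>x. x \<in> C \<Longrightarrow> (1 / t) *\<^sub>R x \<in> {x. \<bar>\<phi> x\<bar> < 1}"
    using tvs_bounded_absorbed[OF assms(1)] linear_0[OF lin] by (metis (mono_tags) abs_zero mem_Collect_eq zero_less_one)
  show ?thesis
  proof (rule that[of t])
    fix x assume "x \<in> C"
    from t(2)[OF this] t(1) show "\<bar>\<phi> x\<bar> \<le> t"
      by (simp add: linear_scale[OF lin] abs_mult field_simps)
  qed
qed

text \<open>Total boundedness: one point is chosen for each vector of integer parts that occurs, and
  equal integer parts mean a difference below 1.\<close>

lemma finite_net_functionals:
  fixes F :: "('a \<Rightarrow> real) set"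
  assumes "finite F" and bnd: "\<And>\<phi>. \<phi> \<in> F \<Longrightarrow> \<exists>B. \<forall>x\<in>D. \<bar>\<phi> x\<bar> \<le> B"
  obtains X where "finite X" "X \<subseteq> D" "\<And>y. y \<in> D \<Longrightarrow> \<exists>x\<in>X. \<forall>\<phi>\<in>F. \<bar>\<phi> y - \<phi> x\<bar> < 1"
proof -
  obtain B where B: "\<And>\<phi> x. \<phi> \<in> F \<Longrightarrow> x \<in> D \<Longrightarrow> \<bar>\<phi> x\<bar> \<le> B \<phi>"
    using bnd by metis
  define c where "c y = (\<lambda>\<phi>\<in>F. \<lfloor>\<phi> y\<rfloor>)" for y
  have "c ` D \<subseteq> PiE F (\<lambda>\<phi>. {\<lfloor>- B \<phi>\<rfloor>..\<lfloor>B \<phi>\<rfloor>})"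
    using B by (auto simp: c_def abs_le_iff intro!: floor_mono) (smt (verit))
  then have fin: "finite (c ` D)"
    by (rule finite_subset) (intro finite_PiE assms(1); simp)
  define X where "X = inv_into D c ` (c ` D)"
  have "\<exists>x\<in>X. \<forall>\<phi>\<in>F. \<bar>\<phi> y - \<phi> x\<bar> < 1" if y: "y \<in> D" for y
  proof -
    define z where "z = inv_into D c (c y)"
    have "c z = c y" unfolding z_def using y by (intro f_inv_into_f) simp
    then have "\<bar>\<phi> y - \<phi> z\<bar> < 1" if "\<phi> \<in> F" for \<phi>
    proof -
      have "\<lfloor>\<phi> z\<rfloor> = \<lfloor>\<phi> y\<rfloor>" using fun_cong[OF \<open>c z = c y\<close>, of \<phi>] that by (simp add: c_def)
      then show ?thesis by linarith
    qed
    moreover have "z \<in> X" using y by (simp add: X_def z_def)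
    ultimately show ?thesis by blast
  qed
  moreover have "X \<subseteq> D" by (auto simp: X_def intro: inv_into_into)
  moreover have "finite X" unfolding X_def using fin by (rule finite_imageI)
  ultimately show ?thesis using that by metis
qed

text \<open>A Schauder projection reduces this to Brouwer's theorem: weights attached to a finite
  net turn \<open>f (p t)\<close> into convex coefficients, and at a fixed point \<open>t\<close> of
  the resulting map \<open>p t\<close> is an average of net points that are within 1 of
  \<open>f (p t)\<close> for all of \<open>F\<close>.\<close>

lemma finite_weak_approximate_fixed_point:
  fixes D :: "'a::real_topological_vector set"
  assumes D: "D \<noteq> {}" "convex D" and f: "continuous_on D f" "f ` D \<subseteq> D"
    and F: "finite F" "F \<subseteq> topological_dual" and bnd: "\<And>\<phi>. \<phi> \<in> F \<Longrightarrow> \<exists>B. \<forall>x\<in>D. \<bar>\<phi> x\<bar> \<le> B"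
  obtains x where "x \<in> D" "\<And>\<phi>. \<phi> \<in> F \<Longrightarrow> \<bar>\<phi> (x - f x)\<bar> \<le> 1"
proof -
  have lin: "linear \<phi>" and cont: "continuous_on UNIV \<phi>" if "\<phi> \<in> F" for \<phi>
    using that F(2) by (auto simp: topological_dual_def)
  obtain X where X: "finite X" "X \<subseteq> D" "\<And>y. y \<in> D \<Longrightarrow> \<exists>x\<in>X. \<forall>\<phi>\<in>F. \<bar>\<phi> y - \<phi> x\<bar> < 1"
    using finite_net_functionals[OF F(1) bnd] by metis
  obtain xs where xs: "set xs = X" using X(1) finite_list by blast
  define N where "N = length xs"
  have xD: "xs ! j \<in> D" if "j < N" for j using that X(2) xs by (auto simp: N_def)
  have N: "N > 0" using X(3) D(1) xs by (auto simp: N_def)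
  \<comment> \<open>The weight is positive exactly if \<open>xs ! j\<close> differs from
    \<open>y\<close> by less than 1 under every functional in \<open>F\<close>.\<close>
  define w where "w j y = (\<Prod>\<phi>\<in>F. max 0 (1 - \<bar>\<phi> y - \<phi> (xs ! j)\<bar>))" for j y
  have w0: "w j y \<ge> 0" for j y unfolding w_def by (intro prod_nonneg) simp
  have wcont: "continuous_on UNIV (w j)" for j
    unfolding w_def by (intro continuous_intros cont)
  have wpos: "(\<Sum>j<N. w j y) > 0" if y: "y \<in> D" for y
  proof -
    obtain x where x: "x \<in> X" "\<forall>\<phi>\<in>F. \<bar>\<phi> y - \<phi> x\<bar> < 1" using X(3)[OF y] by blast
    then obtain j where j: "j < N" "xs ! j = x" using xs by (metis N_def in_set_conv_nth)
    have "w j y > 0" unfolding w_def j(2) using x(2) by (intro prod_pos) auto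
    then show ?thesis using j(1) w0 by (intro sum_pos2[of _ j]) auto
  qed
  define S where "S t = (\<Sum>j<N. t j)" for t :: "nat \<Rightarrow> real"
  \<comment> \<open>\<open>t \<mapsto> (c j t)\<^sub>j\<close> retracts the cube onto the standard simplex.\<close>
  define c where "c j t = (t j + (if j = 0 then max 0 (1 - S t) else 0)) / max 1 (S t)" for j and t :: "nat \<Rightarrow> real"
  have csum: "(\<Sum>j<N. c j t) = 1" for t
  proof -
    have "(\<Sum>j<N. c j t) = (S t + (\<Sum>j<N. if j = 0 then max 0 (1 - S t) else 0)) / max 1 (S t)"
      unfolding c_def S_def by (simp add: sum.distrib flip: sum_divide_distrib)
    also have "(\<Sum>j<N. if j = 0 then max 0 (1 - S t) else 0) = max 0 (1 - S t)"
      using N by (simp add: sum.delta)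
    finally show ?thesis by (auto simp: max_def)
  qed
  have ccont: "continuous_on A (c j)" for j A
  proof -
    have "continuous_on A S" unfolding S_def by (intro continuous_on_sum continuous_on_eval)
    moreover have "continuous_on A (\<lambda>t. t j :: real)" by (rule continuous_on_eval)
    ultimately show ?thesis unfolding c_def by (cases "j = 0") (auto intro!: continuous_intros)
  qed
  define p where "p t = (\<Sum>j<N. c j t *\<^sub>R xs ! j)" for t
  define Q :: "(nat \<Rightarrow> real) set" where "Q = Pi UNIV (\<lambda>_. {0..1})"
  have pD: "p t \<in> D" if "t \<in> Q" for t
    unfolding p_def
  proof (rule convex_sum[OF _ D(2) csum])
    show "c j t \<ge> 0" if "j \<in> {..<N}" for j
      using \<open>t \<in> Q\<close> unfolding c_def by (intro divide_nonneg_pos add_nonneg_nonneg) (auto simp: Q_def)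
  qed (use xD in auto)
  have pcont: "continuous_on Q p" unfolding p_def by (intro continuous_intros ccont)
  have fp: "continuous_on Q (\<lambda>t. f (p t))"
    using continuous_on_compose2[OF f(1) pcont] pD by blast
  define G where "G t j = w j (f (p t)) / (\<Sum>i<N. w i (f (p t)))" for t j
  have fpD: "f (p t) \<in> D" if "t \<in> Q" for t using pD[OF that] f(2) by blast
  have Gsum: "(\<Sum>j<N. G t j) = 1" if "t \<in> Q" for t
    using wpos[OF fpD[OF that]] by (simp add: G_def flip: sum_divide_distrib)
  obtain t where t: "t \<in> Q" "\<And>j. j < N \<Longrightarrow> G t j = t j"
  proof (rule brouwer_cube_nat[of N G, folded Q_def])
    fix j assume "j < N"
    have wfp: "continuous_on Q (\<lambda>t. w i (f (p t)))" for i
      using continuous_on_compose2[OF wcont fp] by blast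
    show "continuous_on Q (\<lambda>t. G t j)"
      unfolding G_def using wpos[OF fpD] by (intro continuous_intros wfp) force
  next
    fix t j assume t: "t \<in> Q" and j: "j < N"
    have "w j (f (p t)) \<le> (\<Sum>i<N. w i (f (p t)))" using j w0 by (intro member_le_sum) auto
    then show "G t j \<in> {0..1}" using wpos[OF fpD[OF t]] w0 by (simp add: G_def)
  qed blast
  \<comment> \<open>The fixed point lies on the simplex, where the retraction is the
    identity.\<close>
  have "S t = 1" using Gsum[OF t(1)] t(2) by (simp add: S_def)
  then have "c j t = t j" for j by (simp add: c_def)
  then have pt: "p t = (\<Sum>j<N. t j *\<^sub>R xs ! j)" by (simp add: p_def)
  have t1: "(\<Sum>j<N. t j) = 1" using \<open>S t = 1\<close> by (simp add: S_def)
  have t0: "t j \<ge> 0" for j using t(1) by (auto simp: Q_def)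
  show ?thesis
  proof (rule that[of "p t"])
    show "p t \<in> D" by (rule pD[OF t(1)])
    fix \<phi> assume \<phi>: "\<phi> \<in> F"
    have "\<phi> (p t - f (p t)) = (\<Sum>j<N. t j * \<phi> (xs ! j)) - (\<Sum>j<N. t j) * \<phi> (f (p t))"
      unfolding t1 by (simp add: linear_diff[OF lin[OF \<phi>]] pt linear_sum[OF lin[OF \<phi>]] linear_scale[OF lin[OF \<phi>]])
    also have "\<dots> = (\<Sum>j<N. t j * (\<phi> (xs ! j) - \<phi> (f (p t))))"
      by (simp add: sum_distrib_right sum_subtractf right_diff_distrib)
    finally have eq: "\<phi> (p t - f (p t)) = (\<Sum>j<N. t j * (\<phi> (xs ! j) - \<phi> (f (p t))))" .
    have "\<bar>t j * (\<phi> (xs ! j) - \<phi> (f (p t)))\<bar> \<le> t j" if j: "j < N" for j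
    proof (cases "\<bar>\<phi> (f (p t)) - \<phi> (xs ! j)\<bar> < 1")
      case True
      then have "t j * \<bar>\<phi> (xs ! j) - \<phi> (f (p t))\<bar> \<le> t j * 1" using t0 by (intro mult_left_mono) auto
      then show ?thesis using t0[of j] by (simp add: abs_mult)
    next
      case False
      then have "w j (f (p t)) = 0" unfolding w_def using \<phi> F(1) by (intro prod_zero) (auto intro!: bexI[of _ \<phi>])
      then have "t j = 0" using t(2)[OF j] by (simp add: G_def)
      then show ?thesis by simp
    qed
    then have "(\<Sum>j<N. \<bar>t j * (\<phi> (xs ! j) - \<phi> (f (p t)))\<bar>) \<le> (\<Sum>j<N. t j)"
      by (intro sum_mono) simp
    then show "\<bar>\<phi> (p t - f (p t))\<bar> \<le> 1" unfolding eq t1 by (rule order_trans[OF sum_abs])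
  qed
qed

section \<open>Polars and countable tightness of the weak topology\<close>

definition polar :: "'a::real_topological_vector set \<Rightarrow> ('a \<Rightarrow> real) set" where
  "polar V = {\<phi>. linear \<phi> \<and> (\<forall>v\<in>V. \<bar>\<phi> v\<bar> \<le> 1)}"

lemma polar_dual: "open V \<Longrightarrow> 0 \<in> V \<Longrightarrow> \<phi> \<in> polar V \<Longrightarrow> \<phi> \<in> topological_dual"
  unfolding polar_def by (blast intro: topological_dualI)

text \<open>The Banach--Alaoglu theorem: in the topology of pointwise convergence the polar is a
  closed subset of a product of intervals, whose sizes \<open>s x\<close> exist because
  \<open>V\<close> is absorbing.\<close>

lemma compact_polar:
  fixes V :: "'a::real_topological_vector set"
  assumes V: "open V" "0 \<in> V"
  shows "compact (polar V)"
proof -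
  have "\<exists>s. s > 0 \<and> (1 / s) *\<^sub>R x \<in> V" for x using absorbing_open[OF V] by (metis order_refl)
  then obtain s where s: "\<And>x. s x > 0" "\<And>x. (1 / s x) *\<^sub>R x \<in> V" by metis
  have "closed {\<phi> :: 'a \<Rightarrow> real. linear \<phi>}"
    unfolding linear_iff
    by (intro closed_Collect_conj closed_Collect_all closed_Collect_eq
        continuous_on_add continuous_on_scaleR continuous_on_const continuous_on_eval)
  moreover have "closed {\<phi> :: 'a \<Rightarrow> real. \<forall>v. v \<in> V \<longrightarrow> \<bar>\<phi> v\<bar> \<le> 1}"
  proof (rule closed_Collect_all)
    show "closed {\<phi> :: 'a \<Rightarrow> real. v \<in> V \<longrightarrow> \<bar>\<phi> v\<bar> \<le> 1}" for v
      by (cases "v \<in> V") (simp_all add: closed_Collect_le continuous_on_rabs continuous_on_eval)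
  qed
  ultimately have "closed ({\<phi> :: 'a \<Rightarrow> real. linear \<phi>} \<inter> {\<phi>. \<forall>v. v \<in> V \<longrightarrow> \<bar>\<phi> v\<bar> \<le> 1})"
    by (rule closed_Int)
  moreover have "compact (Pi UNIV (\<lambda>x. {- s x..s x}))" by (intro compact_Pi_UNIV) simp
  ultimately have "compact (Pi UNIV (\<lambda>x. {- s x..s x}) \<inter> ({\<phi>. linear \<phi>} \<inter> {\<phi>. \<forall>v. v \<in> V \<longrightarrow> \<bar>\<phi> v\<bar> \<le> 1}))"
    by (intro compact_Int_closed)
  moreover have "polar V = Pi UNIV (\<lambda>x. {- s x..s x}) \<inter> ({\<phi>. linear \<phi>} \<inter> {\<phi>. \<forall>v. v \<in> V \<longrightarrow> \<bar>\<phi> v\<bar> \<le> 1})"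
    (is "_ = ?A \<inter> ?B")
  proof -
    have "\<phi> x \<in> {- s x..s x}" if "\<phi> \<in> polar V" for \<phi> x
    proof -
      have "linear \<phi>" "\<bar>\<phi> ((1 / s x) *\<^sub>R x)\<bar> \<le> 1" using that s(2) by (auto simp: polar_def)
      then have "\<bar>\<phi> x\<bar> \<le> s x" using s(1)[of x] by (simp add: linear_scale abs_mult field_simps)
      then show ?thesis by auto
    qed
    then have "polar V \<subseteq> ?A" by blast
    moreover have "polar V = ?B" by (auto simp: polar_def)
    ultimately show ?thesis by blast
  qed
  ultimately show ?thesis by simp
qed

text \<open>Kaplansky's argument for countable tightness of the weak topology, by compactness of powers of
  polars.\<close>

lemma countable_weak_approximate_fixed_points:
  fixes D :: "'a::real_topological_vector set" and V :: "nat \<Rightarrow> 'a set"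
  assumes D: "D \<noteq> {}" "convex D" "tvs_bounded D" and f: "continuous_on D f" "f ` D \<subseteq> D"
    and V: "\<And>m. open (V m)" "\<And>m. 0 \<in> V m" "\<And>U. open U \<Longrightarrow> 0 \<in> U \<Longrightarrow> \<exists>m. V m \<subseteq> U"
  obtains x :: "nat \<Rightarrow> 'a" where "range x \<subseteq> D"
    "\<And>F. finite F \<Longrightarrow> F \<subseteq> topological_dual \<Longrightarrow> \<exists>i. \<forall>\<phi>\<in>F. \<bar>\<phi> (x i - f (x i))\<bar> < 1"
proof -
  \<comment> \<open>Sequences \<open>\<kappa>\<close> encode \<open>n\<close>-tuples of functionals;
    \<open>nbh n x\<close> collects those for which \<open>x\<close> is an approximate fixed point.
    A finite subcover gives finitely many points for each \<open>m\<close> and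
    \<open>n\<close>.\<close>
  define nbh where "nbh n x = {\<kappa> :: nat \<Rightarrow> 'a \<Rightarrow> real. \<forall>i\<in>{..<n}. \<bar>\<kappa> i (x - f x)\<bar> < 1}" for n and x :: 'a
  have openO: "open (nbh n x)" for n x
  proof -
    have "open (\<Inter>i\<in>{..<n}. {\<kappa> :: nat \<Rightarrow> 'a \<Rightarrow> real. \<bar>\<kappa> i (x - f x)\<bar> < 1})"
      by (intro open_INT ballI open_Collect_less continuous_on_rabs continuous_on_const
          continuous_on_eval2) auto
    moreover have "(\<Inter>i\<in>{..<n}. {\<kappa> :: nat \<Rightarrow> 'a \<Rightarrow> real. \<bar>\<kappa> i (x - f x)\<bar> < 1}) = nbh n x"
      by (auto simp: nbh_def)
    ultimately show ?thesis by simp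
  qed
  have "\<exists>X. X \<subseteq> D \<and> finite X \<and> Pi UNIV (\<lambda>_. polar (V m)) \<subseteq> (\<Union>x\<in>X. nbh n x)" for m n
  proof (rule compactE_image)
    show "compact (Pi UNIV (\<lambda>_::nat. polar (V m)))" by (intro compact_Pi_UNIV compact_polar V)
    show "open (nbh n x)" if "x \<in> D" for x by (rule openO)
    show "Pi UNIV (\<lambda>_. polar (V m)) \<subseteq> (\<Union>x\<in>D. nbh n x)"
    proof
      fix \<kappa> :: "nat \<Rightarrow> 'a \<Rightarrow> real" assume \<kappa>: "\<kappa> \<in> Pi UNIV (\<lambda>_. polar (V m))"
      \<comment> \<open>Doubling turns the bound \<open>\<le> 1\<close> into the strict one that
        defines the open cover.\<close>
      define F where "F = (\<lambda>i. \<lambda>x. 2 * \<kappa> i x) ` {..<n}"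
      have dual: "\<kappa> i \<in> topological_dual" for i using polar_dual[OF V(1,2)] \<kappa> by blast
      have "F \<subseteq> topological_dual" unfolding F_def using topological_dual_scale[OF dual] by blast
      moreover from this have "\<exists>B. \<forall>x\<in>D. \<bar>\<phi> x\<bar> \<le> B" if "\<phi> \<in> F" for \<phi>
        using tvs_bounded_dual[OF D(3), of \<phi>] that by (metis subsetD)
      moreover have "finite F" by (simp add: F_def)
      ultimately obtain x where x: "x \<in> D" "\<And>\<phi>. \<phi> \<in> F \<Longrightarrow> \<bar>\<phi> (x - f x)\<bar> \<le> 1"
        using finite_weak_approximate_fixed_point[OF D(1,2) f] by metis
      have "\<bar>\<kappa> i (x - f x)\<bar> < 1" if "i < n" for i
      proof -
        have "(\<lambda>x. 2 * \<kappa> i x) \<in> F" using that by (auto simp: F_def)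
        from x(2)[OF this] show ?thesis by linarith
      qed
      then show "\<kappa> \<in> (\<Union>x\<in>D. nbh n x)" using x(1) by (auto simp: nbh_def)
    qed
    fix X assume "X \<subseteq> D" "finite X" "Pi UNIV (\<lambda>_. polar (V m)) \<subseteq> (\<Union>x\<in>X. nbh n x)"
    then show ?thesis by blast
  qed
  then obtain X where X: "\<And>m n. X m n \<subseteq> D" "\<And>m n. finite (X m n)"
    "\<And>m n. Pi UNIV (\<lambda>_. polar (V m)) \<subseteq> (\<Union>x\<in>X m n. nbh n x)" by metis
  obtain x0 where x0: "x0 \<in> D" using D(1) by blast
  define S where "S = insert x0 (\<Union>m n. X m n)"
  have "countable S"
    unfolding S_def by (intro countable_insert countable_UN countableI_type countable_finite X(2))
  moreover have "S \<noteq> {}" "S \<subseteq> D" using X(1) x0 by (auto simp: S_def)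
  ultimately have S: "countable S" "S \<noteq> {}" "S \<subseteq> D" by blast+
  define x where "x = from_nat_into S"
  have range: "range x = S" unfolding x_def using S by (intro range_from_nat_into)
  show ?thesis
  proof (rule that[of x])
    show "range x \<subseteq> D" using range S(3) by simp
    fix F :: "('a \<Rightarrow> real) set" assume F: "finite F" "F \<subseteq> topological_dual"
    have lin: "linear \<phi>" and cont: "continuous_on UNIV \<phi>" if "\<phi> \<in> F" for \<phi>
      using that F(2) by (auto simp: topological_dual_def)
    have "open (\<Inter>\<phi>\<in>F. {x. \<bar>\<phi> x\<bar> < 1})"
      using F(1) by (intro open_INT ballI open_Collect_less continuous_intros cont) auto
    moreover have "0 \<in> (\<Inter>\<phi>\<in>F. {x. \<bar>\<phi> x\<bar> < 1})"
    proof (intro INT_I CollectI)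
      fix \<phi> assume "\<phi> \<in> F"
      then show "\<bar>\<phi> 0\<bar> < 1" by (simp add: linear_0[OF lin])
    qed
    ultimately obtain m where m: "V m \<subseteq> (\<Inter>\<phi>\<in>F. {x. \<bar>\<phi> x\<bar> < 1})" using V(3) by blast
    obtain \<phi>s where \<phi>s: "set \<phi>s = F" using F(1) finite_list by blast
    define \<kappa> where "\<kappa> i = (if i < length \<phi>s then \<phi>s ! i else (\<lambda>_. 0))" for i
    have "F \<subseteq> polar (V m)" using m lin by (force simp: polar_def less_imp_le)
    moreover have "(\<lambda>_. 0) \<in> polar (V m)" by (simp add: polar_def linear_zero)
    ultimately have "\<kappa> i \<in> polar (V m)" for i using nth_mem[of i \<phi>s] \<phi>s by (auto simp: \<kappa>_def)
    then have "\<kappa> \<in> (\<Union>x\<in>X m (length \<phi>s). nbh (length \<phi>s) x)" using X(3) by blast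
    then obtain y where y: "y \<in> X m (length \<phi>s)" "\<kappa> \<in> nbh (length \<phi>s) y" by blast
    then have "y \<in> range x" unfolding range S_def by blast
    then obtain i where i: "y = x i" by blast
    have "\<bar>\<phi> (y - f y)\<bar> < 1" if \<phi>: "\<phi> \<in> F" for \<phi>
    proof -
      obtain j where "j < length \<phi>s" "\<phi>s ! j = \<phi>"
        using \<phi> unfolding \<phi>s[symmetric] in_set_conv_nth by blast
      then show ?thesis using y(2) by (auto simp: nbh_def \<kappa>_def)
    qed
    then show "\<exists>i. \<forall>\<phi>\<in>F. \<bar>\<phi> (x i - f (x i))\<bar> < 1" using i by blast
  qed
qed

section \<open>Independent sequences are \<open>\<ell>\<^sub>1\<close>-sequences\<close>

lemma ell1_map_diff:
  assumes "a \<in> ell1_fin" "b \<in> ell1_fin"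
  shows "ell1_map y (\<lambda>i. a i - b i) = ell1_map y a - ell1_map y b"
    and "(\<lambda>i. a i - b i) \<in> ell1_fin"
proof -
  define S where "S = {i. a i \<noteq> 0} \<union> {i. b i \<noteq> 0}"
  have S: "finite S" using assms by (simp add: S_def ell1_fin_def)
  have sub: "{i. a i \<noteq> 0} \<subseteq> S" "{i. b i \<noteq> 0} \<subseteq> S" "{i. a i - b i \<noteq> 0} \<subseteq> S" by (auto simp: S_def)
  show "ell1_map y (\<lambda>i. a i - b i) = ell1_map y a - ell1_map y b"
    using S sub by (simp add: sum_ell1_support(2)[OF S] scaleR_diff_left sum_subtractf)
  show "(\<lambda>i. a i - b i) \<in> ell1_fin" using finite_subset[OF sub(3) S] by (simp add: ell1_fin_def)
qed

text \<open>Continuity of \<open>ell1_map y\<close> at 0: its value is a combination of the points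
  \<open>z i\<close>, which lie in a convex symmetric neighbourhood, with nonnegative weights
  \<open>t * \<bar>a i\<bar>\<close> of sum below 1.\<close>

lemma ell1_map_small:
  fixes C :: "'a::real_locally_convex set"
  assumes C: "tvs_bounded C" "range y \<subseteq> C" and W: "open W" "0 \<in> W"
  obtains d where "d > 0" "\<And>a. a \<in> ell1_fin \<Longrightarrow> ell1_norm a < d \<Longrightarrow> ell1_map y a \<in> W"
proof -
  obtain V where V: "open V" "0 \<in> V" "V \<subseteq> W" "convex V" "\<And>x. x \<in> V \<Longrightarrow> - x \<in> V"
    using symmetric_convex_nhds_0[OF W] by metis
  obtain t where t: "t > 0" "\<And>x. x \<in> C \<Longrightarrow> (1 / t) *\<^sub>R x \<in> V"
    using tvs_bounded_absorbed[OF C(1) V(1,2)] by metis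
  show ?thesis
  proof (rule that[of "1 / t"])
    show "1 / t > 0" using t by simp
    fix a assume a: "a \<in> ell1_fin" "ell1_norm a < 1 / t"
    define S where "S = {i. a i \<noteq> 0}"
    have S: "finite S" using a by (simp add: S_def ell1_fin_def)
    define z where "z i = (sgn (a i) / t) *\<^sub>R y i" for i
    have z: "z i \<in> V" for i
    proof -
      have "(1 / t) *\<^sub>R y i \<in> V" using t(2) C(2) by blast
      then show ?thesis using V(2) V(5)[of "(1 / t) *\<^sub>R y i"] by (auto simp: z_def sgn_if)
    qed
    have n: "(\<Sum>i\<in>S. t * \<bar>a i\<bar>) < 1"
      using a(2) t(1) by (simp add: ell1_norm_def S_def field_simps flip: sum_distrib_left)
    have "ell1_map y a = (\<Sum>i\<in>S. (t * \<bar>a i\<bar>) *\<^sub>R z i)"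
      unfolding ell1_map_def S_def[symmetric] using t(1) by (intro sum.cong) (auto simp: z_def abs_mult_sgn mult.commute)
    also have "\<dots> \<in> V"
    proof (cases "S = {}")
      case False
      define T where "T = (\<Sum>i\<in>S. t * \<bar>a i\<bar>)"
      have T: "T > 0" "T < 1" using n False S t(1) unfolding T_def by (auto simp: S_def intro!: sum_pos)
      define v where "v = (\<Sum>i\<in>S. (t * \<bar>a i\<bar> / T) *\<^sub>R z i)"
      have "v \<in> V" unfolding v_def
      proof (rule convex_sum[OF S V(4)])
        show "(\<Sum>i\<in>S. t * \<bar>a i\<bar> / T) = 1" using T by (simp add: T_def flip: sum_divide_distrib)
      qed (use T t(1) z in auto)
      then have "T *\<^sub>R v + (1 - T) *\<^sub>R 0 \<in> V" using T V(2) by (intro convexD[OF V(4)]) auto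
      moreover have "T *\<^sub>R v = (\<Sum>i\<in>S. (t * \<bar>a i\<bar>) *\<^sub>R z i)"
        using T by (simp add: v_def scaleR_sum_right)
      ultimately show ?thesis by simp
    qed (use V(2) in simp)
    finally show "ell1_map y a \<in> W" using V(3) by blast
  qed
qed

text \<open>Rosenthal's estimate: take functionals for the set where \<open>a\<close> is positive
  and for its complement. Their difference is at least \<open>s - r\<close> on the first set and at
  most \<open>r - s\<close> on the second, so no terms cancel, while each functional is at most
  \<open>d\<close> in modulus at the vector.\<close>

lemma independent_imp_ell1_lower_bound:
  fixes y :: "nat \<Rightarrow> 'a::real_topological_vector"
  assumes rs: "r < s"
    and ind: "\<And>P. \<exists>\<phi>\<in>polar V. \<forall>l. if l \<in> P then s \<le> \<phi> (y l) else \<phi> (y l) \<le> r"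
    and a: "a \<in> ell1_fin" and d: "d > 0" "(1 / d) *\<^sub>R ell1_map y a \<in> V"
  shows "(s - r) * ell1_norm a \<le> 2 * d"
proof -
  define S where "S = {i. a i \<noteq> 0}"
  obtain \<phi> where \<phi>: "\<phi> \<in> polar V" "\<And>l. if l \<in> {i. a i > 0} then s \<le> \<phi> (y l) else \<phi> (y l) \<le> r"
    using ind[of "{i. a i > 0}"] by blast
  obtain \<psi> where \<psi>: "\<psi> \<in> polar V" "\<And>l. if l \<in> - {i. a i > 0} then s \<le> \<psi> (y l) else \<psi> (y l) \<le> r"
    using ind[of "- {i. a i > 0}"] by blast
  have bd: "\<bar>\<eta> (ell1_map y a)\<bar> \<le> d" and sum: "\<eta> (ell1_map y a) = (\<Sum>i\<in>S. a i * \<eta> (y i))"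
    if "\<eta> \<in> polar V" for \<eta>
  proof -
    have lin: "linear \<eta>" and "\<bar>\<eta> ((1 / d) *\<^sub>R ell1_map y a)\<bar> \<le> 1" using that d(2) by (auto simp: polar_def)
    then show "\<bar>\<eta> (ell1_map y a)\<bar> \<le> d" using d(1) by (simp add: linear_scale abs_mult field_simps)
    show "\<eta> (ell1_map y a) = (\<Sum>i\<in>S. a i * \<eta> (y i))"
      by (simp add: ell1_map_def S_def linear_sum[OF lin] linear_scale[OF lin])
  qed
  have "(s - r) * ell1_norm a = (\<Sum>i\<in>S. (s - r) * \<bar>a i\<bar>)"
    by (simp add: ell1_norm_def S_def sum_distrib_left)
  also have "\<dots> \<le> (\<Sum>i\<in>S. a i * \<phi> (y i) - a i * \<psi> (y i))"
  proof (rule sum_mono)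
    fix i
    show "(s - r) * \<bar>a i\<bar> \<le> a i * \<phi> (y i) - a i * \<psi> (y i)"
    proof (cases "a i > 0")
      case True
      then have "s - r \<le> \<phi> (y i) - \<psi> (y i)" using \<phi>(2)[of i] \<psi>(2)[of i] by auto
      then have "a i * (s - r) \<le> a i * (\<phi> (y i) - \<psi> (y i))" using True by (intro mult_left_mono) auto
      then show ?thesis using True by (simp add: algebra_simps)
    next
      case False
      then have "s - r \<le> \<psi> (y i) - \<phi> (y i)" using \<phi>(2)[of i] \<psi>(2)[of i] by auto
      then have "- a i * (s - r) \<le> - a i * (\<psi> (y i) - \<phi> (y i))" using False by (intro mult_left_mono) auto
      then show ?thesis using False by (simp add: algebra_simps)
    qed
  qed
  also have "\<dots> = \<phi> (ell1_map y a) - \<psi> (ell1_map y a)"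
    by (simp add: sum[OF \<phi>(1)] sum[OF \<psi>(1)] sum_subtractf)
  also have "\<dots> \<le> 2 * d" using bd[OF \<phi>(1)] bd[OF \<psi>(1)] by linarith
  finally show ?thesis .
qed

lemma ell1_norm_nonneg: "ell1_norm a \<ge> 0"
  by (simp add: ell1_norm_def sum_nonneg)

text \<open>Boundedness of \<open>C\<close> gives continuity; the lower estimate gives injectivity
  and openness onto the image.\<close>

lemma independent_imp_ell1_sequence:
  fixes y :: "nat \<Rightarrow> 'a::real_locally_convex"
  assumes C: "tvs_bounded C" "range y \<subseteq> C" and V: "open V" "0 \<in> V" and rs: "r < s"
    and ind: "\<And>P. \<exists>\<phi>\<in>polar V. \<forall>l. if l \<in> P then s \<le> \<phi> (y l) else \<phi> (y l) \<le> r"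
  shows "ell1_sequence y"
  unfolding ell1_sequence_def
proof (rule bijective_open_imp_homeomorphic_map)
  let ?h = "ell1_map y"
  have lower: "ell1_norm a * (s - r) \<le> 2 * d"
    if "a \<in> ell1_fin" "d > 0" "(1 / d) *\<^sub>R ?h a \<in> V" for a d
    using independent_imp_ell1_lower_bound[OF rs ind that] by (simp add: mult.commute)
  show "continuous_map ell1_fin.mtopology (top_of_set (?h ` ell1_fin)) ?h"
  proof (subst continuous_map_in_subtopology, intro conjI)
    show "continuous_map ell1_fin.mtopology euclidean ?h"
      unfolding continuous_map_def
    proof (intro conjI allI impI)
      fix W :: "'a set" assume "openin euclidean W"
      then have W: "open W" by simp
      have "\<exists>d>0. ell1_fin.mball a d \<subseteq> {x \<in> ell1_fin. ?h x \<in> W}" if a: "a \<in> ell1_fin" "?h a \<in> W" for a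
      proof -
        have "open {z. ?h a - z \<in> W}"
          by (intro open_vimage[OF W, unfolded vimage_def] continuous_intros)
        moreover have "0 \<in> {z. ?h a - z \<in> W}" using a by simp
        ultimately obtain d where d: "d > 0"
          "\<And>b. b \<in> ell1_fin \<Longrightarrow> ell1_norm b < d \<Longrightarrow> ?h b \<in> {z. ?h a - z \<in> W}"
          using ell1_map_small[OF C] by metis
        have "?h b \<in> W" if b: "b \<in> ell1_fin" "ell1_dist a b < d" for b
          using d(2)[OF ell1_map_diff(2)[OF a(1) b(1)]] b(2)
          by (simp add: ell1_dist_def ell1_map_diff(1)[OF a(1) b(1)])
        then show ?thesis using d(1) by (intro exI[of _ d]) auto
      qed
      then show "openin ell1_fin.mtopology {x \<in> topspace ell1_fin.mtopology. ?h x \<in> W}"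
        by (auto simp: ell1_fin.openin_mtopology)
    qed simp
  qed simp
  show "inj_on ?h (topspace ell1_fin.mtopology)"
  proof (rule inj_onI)
    fix a b assume "a \<in> topspace ell1_fin.mtopology" "b \<in> topspace ell1_fin.mtopology" and eq: "?h a = ?h b"
    then have ab: "a \<in> ell1_fin" "b \<in> ell1_fin" by simp_all
    have "?h (\<lambda>i. a i - b i) = 0" using ell1_map_diff(1)[OF ab, of y] eq by simp
    \<comment> \<open>The vector 0 lies in every multiple of \<open>V\<close>, so
      \<open>lower\<close> applies with arbitrarily small \<open>d\<close>.\<close>
    then have "ell1_dist a b * (s - r) \<le> 0 + e" if "e > 0" for e
      using lower[OF ell1_map_diff(2)[OF ab], of "e / 2"] that V(2) by (simp add: ell1_dist_def)
    then have "ell1_dist a b * (s - r) \<le> 0" by (rule field_le_epsilon)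
    then have "ell1_dist a b \<le> 0" using rs by (simp add: mult_le_0_iff)
    then have "ell1_dist a b = 0" using ell1_norm_nonneg by (simp add: ell1_dist_def antisym)
    then show "a = b" using ell1_fin.zero[OF ab] by simp
  qed
  show "open_map ell1_fin.mtopology (top_of_set (?h ` ell1_fin)) ?h"
    unfolding open_map_def
  proof (intro allI impI)
    fix U assume U: "openin ell1_fin.mtopology U"
    have Usub: "U \<subseteq> ell1_fin" using openin_subset[OF U] by simp
    show "openin (top_of_set (?h ` ell1_fin)) (?h ` U)"
    proof (subst openin_subopen, intro ballI)
      fix w assume "w \<in> ?h ` U"
      then obtain a where a: "a \<in> U" "w = ?h a" by blast
      obtain d where d: "d > 0" "ell1_fin.mball a d \<subseteq> U"
        using U a(1) by (auto simp: ell1_fin.openin_mtopology)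
      \<comment> \<open>Chosen so that \<open>2 * c\<close> is half of
        \<open>d * (s - r)\<close>.\<close>
      define c where "c = d * (s - r) / 4"
      have c: "c > 0" using d rs by (simp add: c_def)
      define T where "T = {z. (1 / c) *\<^sub>R (?h a - z) \<in> V}"
      have "open T" unfolding T_def by (intro open_vimage[OF V(1), unfolded vimage_def] continuous_intros)
      then have "openin (top_of_set (?h ` ell1_fin)) (?h ` ell1_fin \<inter> T)" by (rule openin_open_Int)
      moreover have "w \<in> ?h ` ell1_fin \<inter> T" using a Usub V(2) by (auto simp: T_def)
      moreover have "?h ` ell1_fin \<inter> T \<subseteq> ?h ` U"
      proof
        fix v assume "v \<in> ?h ` ell1_fin \<inter> T"
        then obtain b where b: "b \<in> ell1_fin" "v = ?h b" "(1 / c) *\<^sub>R (?h a - ?h b) \<in> V" by (auto simp: T_def)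
        have a': "a \<in> ell1_fin" using a Usub by blast
        have "ell1_dist a b * (s - r) \<le> 2 * c"
          using lower[OF ell1_map_diff(2)[OF a' b(1)] c] b(3) by (simp add: ell1_map_diff(1)[OF a' b(1)] ell1_dist_def)
        also have "2 * c < d * (s - r)" using d rs by (simp add: c_def)
        finally have "ell1_dist a b < d" using rs by simp
        then show "v \<in> ?h ` U" using d(2) a' b(1,2) by auto
      qed
      ultimately show "\<exists>T. openin (top_of_set (?h ` ell1_fin)) T \<and> w \<in> T \<and> T \<subseteq> ?h ` U" by blast
    qed
  qed
  show "?h ` topspace ell1_fin.mtopology = topspace (top_of_set (?h ` ell1_fin))" by simp
qed

section \<open>The equivalence\<close>

lemma metrizable_nhds_base_0:
  assumes "metrizable_space (euclidean :: 'a::real_topological_vector topology)"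
  obtains V :: "nat \<Rightarrow> 'a::real_topological_vector set" where "\<And>m. open (V m)" "\<And>m. 0 \<in> V m"
    "\<And>U. open U \<Longrightarrow> 0 \<in> U \<Longrightarrow> \<exists>m. V m \<subseteq> U"
proof -
  have "\<exists>\<B>. countable \<B> \<and> (\<forall>V\<in>\<B>. open V) \<and>
      (\<forall>U. open U \<and> 0 \<in> U \<longrightarrow> (\<exists>V\<in>\<B>. (0 :: 'a) \<in> V \<and> V \<subseteq> U))"
    using metrizable_imp_first_countable[OF assms] unfolding first_countable_def by simp
  then obtain \<B> :: "'a set set" where \<B>: "countable \<B>" "\<forall>V\<in>\<B>. open V"
    "\<forall>U. open U \<and> 0 \<in> U \<longrightarrow> (\<exists>V\<in>\<B>. 0 \<in> V \<and> V \<subseteq> U)"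
    by (elim exE conjE)
  define \<V> where "\<V> = {V \<in> \<B>. 0 \<in> V}"
  have ne: "\<V> \<noteq> {}" using \<B>(3)[rule_format, of UNIV] by (auto simp: \<V>_def)
  have range: "range (from_nat_into \<V>) = \<V>"
    using \<B>(1) ne by (intro range_from_nat_into) (auto simp: \<V>_def)
  show ?thesis
  proof (rule that[of "from_nat_into \<V>"])
    show "open (from_nat_into \<V> m)" "0 \<in> from_nat_into \<V> m" for m
      using from_nat_into[OF ne, of m] \<B>(2) by (auto simp: \<V>_def)
    show "\<exists>m. from_nat_into \<V> m \<subseteq> U" if U: "open U" "0 \<in> U" for U
    proof -
      obtain W where W: "W \<in> \<V>" "W \<subseteq> U" using \<B>(3)[rule_format, of U] U by (auto simp: \<V>_def)
      then obtain m where "W = from_nat_into \<V> m" using range by (metis imageE)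
      then show ?thesis using W(2) by blast
    qed
  qed
qed

text \<open>The independent alternative would give an \<open>\<ell>\<^sub>1\<close>-sequence in
  \<open>C\<close>, so small oscillation holds on each polar. Every continuous functional lies in
  the polar of some \<open>V m\<close>, hence the union over \<open>m\<close> serves the whole dual.
  The bound 1 stands for every positive bound, since functionals can be rescaled.\<close>

lemma ultrafilter_weak_oscillation:
  fixes y :: "nat \<Rightarrow> 'a::real_locally_convex" and V :: "nat \<Rightarrow> 'a set"
  assumes V: "\<And>m. open (V m)" "\<And>m. 0 \<in> V m" "\<And>U. open U \<Longrightarrow> 0 \<in> U \<Longrightarrow> \<exists>m. V m \<subseteq> U"
    and C: "tvs_bounded C" "range y \<subseteq> C" and U: "ultrafilter U"
    and no: "\<not> (\<exists>x :: nat \<Rightarrow> 'a. range x \<subseteq> C \<and> ell1_sequence x)"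
  obtains \<B> where "countable \<B>" "\<B> \<subseteq> U"
    "\<And>\<phi>. \<phi> \<in> topological_dual \<Longrightarrow> \<exists>B\<in>\<B>. \<forall>i\<in>B. \<forall>j\<in>B. \<bar>\<phi> (y i) - \<phi> (y j)\<bar> \<le> 1"
proof -
  have "\<exists>\<B>. countable \<B> \<and> \<B> \<subseteq> U \<and>
    (\<forall>\<phi>\<in>polar (V m). \<exists>B\<in>\<B>. \<forall>i\<in>B. \<forall>j\<in>B. \<bar>\<phi> (y i) - \<phi> (y j)\<bar> \<le> 1)" for m
  proof -
    define K where "K = (\<lambda>\<phi> i. \<phi> (y i)) ` polar (V m)"
    have "continuous_on (polar (V m)) (\<lambda>\<phi> i. \<phi> (y i))"
      by (intro continuous_on_coordinatewise_then_product continuous_on_eval)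
    then have K: "compact K" unfolding K_def using compact_polar[OF V(1,2)] by (rule compact_continuous_image)
    obtain t where t: "t > 0" "\<And>x. x \<in> C \<Longrightarrow> (1 / t) *\<^sub>R x \<in> V m"
      using tvs_bounded_absorbed[OF C(1) V(1,2)] by metis
    have bnd: "\<bar>k i\<bar> \<le> t" if k: "k \<in> K" for k i
    proof -
      obtain \<phi> where \<phi>: "\<phi> \<in> polar (V m)" "k = (\<lambda>i. \<phi> (y i))" using k by (auto simp: K_def)
      have "(1 / t) *\<^sub>R y i \<in> V m" using t(2) C(2) by blast
      then have "linear \<phi>" "\<bar>\<phi> ((1 / t) *\<^sub>R y i)\<bar> \<le> 1" using \<phi>(1) by (auto simp: polar_def)
      then show ?thesis using t(1) \<phi>(2) by (simp add: linear_scale abs_mult field_simps)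
    qed
    show ?thesis
    proof (rule ultrafilter_dichotomy[OF K _ U])
      show "\<bar>k i\<bar> \<le> t" if "k \<in> K" for k i using that by (rule bnd)
    next
      assume "\<And>e. e > 0 \<Longrightarrow> \<exists>\<B>. countable \<B> \<and> \<B> \<subseteq> U \<and>
        (\<forall>k\<in>K. \<exists>B\<in>\<B>. \<forall>i\<in>B. \<forall>j\<in>B. \<bar>k i - k j\<bar> \<le> e)"
      from this[of 1] show ?thesis by (simp add: K_def)
    next
      fix n r s assume independent: "r < s"
        "\<And>P. \<exists>k\<in>K. \<forall>l::nat. if l \<in> P then s \<le> k (n l) else k (n l) \<le> r"
      have sub: "range (\<lambda>l. y (n l)) \<subseteq> C" using C(2) by blast
      have "ell1_sequence (\<lambda>l. y (n l))"
      proof (rule independent_imp_ell1_sequence[OF C(1) _ V(1,2) independent(1)])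
        show "range (\<lambda>l. y (n l)) \<subseteq> C" by (rule sub)
        show "\<exists>\<phi>\<in>polar (V m). \<forall>l. if l \<in> P then s \<le> \<phi> (y (n l)) else \<phi> (y (n l)) \<le> r" for P
          using independent(2)[of P] by (simp add: K_def)
      qed
      with no sub show ?thesis by metis
    qed
  qed
  then obtain \<B> where \<B>: "\<And>m. countable (\<B> m)" "\<And>m. \<B> m \<subseteq> U"
    "\<And>m \<phi>. \<phi> \<in> polar (V m) \<Longrightarrow> \<exists>B\<in>\<B> m. \<forall>i\<in>B. \<forall>j\<in>B. \<bar>\<phi> (y i) - \<phi> (y j)\<bar> \<le> 1"
    by metis
  show ?thesis
  proof (rule that[of "\<Union>m. \<B> m"])
    show "countable (\<Union>m. \<B> m)" using \<B>(1) by (intro countable_UN countableI_type)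
    show "(\<Union>m. \<B> m) \<subseteq> U" using \<B>(2) by blast
    fix \<phi> :: "'a \<Rightarrow> real" assume \<phi>: "\<phi> \<in> topological_dual"
    then have lin: "linear \<phi>" and cont: "continuous_on UNIV \<phi>" by (auto simp: topological_dual_def)
    have "open {x. \<bar>\<phi> x\<bar> < 1}" by (intro open_Collect_less continuous_intros cont)
    moreover have "0 \<in> {x. \<bar>\<phi> x\<bar> < 1}" using linear_0[OF lin] by simp
    ultimately obtain m where "V m \<subseteq> {x. \<bar>\<phi> x\<bar> < 1}" using V(3) by blast
    then have "\<phi> \<in> polar (V m)" using lin by (force simp: polar_def less_imp_le)
    from \<B>(3)[OF this] obtain B where B: "B \<in> \<B> m" "\<forall>i\<in>B. \<forall>j\<in>B. \<bar>\<phi> (y i) - \<phi> (y j)\<bar> \<le> 1" ..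
    have "B \<in> (\<Union>m. \<B> m)" using B(1) by blast
    with B(2) show "\<exists>B\<in>\<Union>m. \<B> m. \<forall>i\<in>B. \<forall>j\<in>B. \<bar>\<phi> (y i) - \<phi> (y j)\<bar> \<le> 1" ..
  qed
qed

text \<open>A diagonal choice: \<open>n k\<close> lies in the first \<open>k + 1\<close> sets of an
  enumeration. Inserting \<open>UNIV\<close> keeps the enumerated family nonempty.\<close>

lemma ultrafilter_pseudo_intersection:
  assumes U: "ultrafilter U" and \<B>: "countable \<B>" "\<B> \<subseteq> U"
  obtains n :: "nat \<Rightarrow> 'i" where "\<And>B. B \<in> \<B> \<Longrightarrow> \<forall>\<^sub>F k in sequentially. n k \<in> B"
proof -
  have "UNIV \<in> U" using ultrafilter_Inter[OF U, of "{}"] by simp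
  then have \<B>': "countable (insert UNIV \<B>)" "insert UNIV \<B> \<subseteq> U" using \<B> by auto
  define B where "B = from_nat_into (insert UNIV \<B>)"
  have range: "range B = insert UNIV \<B>" unfolding B_def using \<B>'(1) by (intro range_from_nat_into) auto
  have "B k \<in> U" for k using range \<B>'(2) by blast
  then have "\<Inter>(B ` {..k}) \<in> U" for k by (intro ultrafilter_Inter[OF U]) auto
  then have "\<Inter>(B ` {..k}) \<noteq> {}" for k using U unfolding ultrafilter_def by metis
  then have "\<forall>k. \<exists>m. m \<in> \<Inter>(B ` {..k})" by blast
  then obtain n where n: "\<And>k. n k \<in> \<Inter>(B ` {..k})" by metis
  show ?thesis
  proof (rule that[of n])
    fix A assume "A \<in> \<B>"
    then obtain l where "A = B l" using range by (metis imageE insertI2)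
    then have "n k \<in> A" if "k \<ge> l" for k using n[of k] that by auto
    then show "\<forall>\<^sub>F k in sequentially. n k \<in> A" unfolding eventually_sequentially by blast
  qed
qed

lemma no_ell1_sequence_imp_weak_AFPP:
  fixes C :: "'a::real_locally_convex set"
  assumes metr: "metrizable_space (euclidean :: 'a topology)"
    and C: "tvs_bounded C" and D: "D \<noteq> {}" "convex D" "D \<subseteq> C"
    and no: "\<not> (\<exists>x :: nat \<Rightarrow> 'a. range x \<subseteq> C \<and> ell1_sequence x)"
  shows "weak_AFPP D"
  unfolding weak_AFPP_def
proof (intro allI impI)
  fix f assume "continuous_on D f \<and> f ` D \<subseteq> D"
  then have f: "continuous_on D f" "f ` D \<subseteq> D" by auto
  obtain V :: "nat \<Rightarrow> 'a set" where V: "\<And>m. open (V m)" "\<And>m. 0 \<in> V m"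
    "\<And>U. open U \<Longrightarrow> 0 \<in> U \<Longrightarrow> \<exists>m. V m \<subseteq> U"
    using metrizable_nhds_base_0[OF metr] by metis
  have "tvs_bounded D" using C D(3) unfolding tvs_bounded_def by (meson subset_trans)
  then obtain x :: "nat \<Rightarrow> 'a" where x: "range x \<subseteq> D"
    "\<And>F. finite F \<Longrightarrow> F \<subseteq> topological_dual \<Longrightarrow> \<exists>i. \<forall>\<phi>\<in>F. \<bar>\<phi> (x i - f (x i))\<bar> < 1"
    using countable_weak_approximate_fixed_points[OF D(1,2) _ f V] by metis
  \<comment> \<open>Any finitely many of these sets meet by the choice of \<open>x\<close>. Along an
    ultrafilter containing all of them, \<open>x i - f (x i)\<close> tends weakly to 0.\<close>
  define A where "A \<phi> = {i. \<bar>\<phi> (x i - f (x i))\<bar> < 1}" for \<phi> :: "'a \<Rightarrow> real"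
  obtain U where U: "ultrafilter U" "A ` topological_dual \<subseteq> U"
  proof (rule ultrafilter_exists[of "A ` topological_dual"])
    fix \<G> assume "finite \<G>" "\<G> \<subseteq> A ` topological_dual"
    then obtain F where F: "F \<subseteq> topological_dual" "finite F" "\<G> = A ` F"
      by (meson finite_subset_image)
    then show "\<Inter>\<G> \<noteq> {}" using x(2)[of F] by (auto simp: A_def)
  qed blast
  have xC: "range x \<subseteq> C" "range (\<lambda>i. f (x i)) \<subseteq> C" using x(1) D(3) f(2) by blast+
  obtain \<B> where \<B>: "countable \<B>" "\<B> \<subseteq> U"
    "\<And>\<phi>. \<phi> \<in> topological_dual \<Longrightarrow> \<exists>B\<in>\<B>. \<forall>i\<in>B. \<forall>j\<in>B. \<bar>\<phi> (x i) - \<phi> (x j)\<bar> \<le> 1"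
    using ultrafilter_weak_oscillation[OF V C xC(1) U(1) no] by metis
  obtain \<B>' where \<B>': "countable \<B>'" "\<B>' \<subseteq> U"
    "\<And>\<phi>. \<phi> \<in> topological_dual \<Longrightarrow> \<exists>B\<in>\<B>'. \<forall>i\<in>B. \<forall>j\<in>B. \<bar>\<phi> (f (x i)) - \<phi> (f (x j))\<bar> \<le> 1"
    using ultrafilter_weak_oscillation[OF V C xC(2) U(1) no] by metis
  obtain n where n: "\<And>B. B \<in> \<B> \<union> \<B>' \<Longrightarrow> \<forall>\<^sub>F k in sequentially. n k \<in> B"
    using ultrafilter_pseudo_intersection[OF U(1), of "\<B> \<union> \<B>'"] \<B>(1,2) \<B>'(1,2)
    by (metis Un_least countable_Un)
  show "\<exists>z :: nat \<Rightarrow> 'a. range z \<subseteq> D \<and> (\<forall>\<phi>\<in>topological_dual. (\<lambda>k. \<phi> (z k - f (z k))) \<longlonglongrightarrow> 0)"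
  proof (intro exI[of _ "\<lambda>k. x (n k)"] conjI ballI)
    show "range (\<lambda>k. x (n k)) \<subseteq> D" using x(1) by blast
    fix \<phi> :: "'a \<Rightarrow> real" assume \<phi>: "\<phi> \<in> topological_dual"
    show "(\<lambda>k. \<phi> (x (n k) - f (x (n k)))) \<longlonglongrightarrow> 0"
    proof (rule tendstoI)
      fix e :: real assume e: "e > 0"
      \<comment> \<open>Two oscillations of at most 1 and one value below 1 stay below 4, which
        corresponds to \<open>e\<close> for \<open>\<phi>\<close>.\<close>
      define \<psi> where "\<psi> v = (4 / e) * \<phi> v" for v
      have \<psi>: "\<psi> \<in> topological_dual" unfolding \<psi>_def using topological_dual_scale[OF \<phi>] .
      then have lin: "linear \<psi>" by (simp add: topological_dual_def)
      obtain B where B: "B \<in> \<B>" "\<And>i j. i \<in> B \<Longrightarrow> j \<in> B \<Longrightarrow> \<bar>\<psi> (x i) - \<psi> (x j)\<bar> \<le> 1"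
        using \<B>(3)[OF \<psi>] by blast
      obtain B' where B': "B' \<in> \<B>'" "\<And>i j. i \<in> B' \<Longrightarrow> j \<in> B' \<Longrightarrow> \<bar>\<psi> (f (x i)) - \<psi> (f (x j))\<bar> \<le> 1"
        using \<B>'(3)[OF \<psi>] by blast
      \<comment> \<open>The sequence \<open>n\<close> follows only the countable families, so
        \<open>n k\<close> may lie outside \<open>A \<psi>\<close>; the common index
        \<open>j\<close> carries the bound over to it.\<close>
      have "\<Inter>{B, B', A \<psi>} \<in> U"
        using U B(1) B'(1) \<B>(2) \<B>'(2) \<psi> by (intro ultrafilter_Inter) auto
      then have "\<Inter>{B, B', A \<psi>} \<noteq> {}" using U(1) unfolding ultrafilter_def by metis
      then obtain j where j: "j \<in> B" "j \<in> B'" "j \<in> A \<psi>" by auto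
      have "\<forall>\<^sub>F k in sequentially. n k \<in> B" "\<forall>\<^sub>F k in sequentially. n k \<in> B'"
        using n B(1) B'(1) by auto
      then show "\<forall>\<^sub>F k in sequentially. dist (\<phi> (x (n k) - f (x (n k)))) 0 < e"
      proof eventually_elim
        case (elim k)
        have "\<bar>\<psi> (x j) - \<psi> (f (x j))\<bar> < 1" using j(3) by (simp add: A_def linear_diff[OF lin])
        then have "\<bar>\<psi> (x (n k)) - \<psi> (f (x (n k)))\<bar> < 4"
          using B(2)[OF elim(1) j(1)] B'(2)[OF elim(2) j(2)] by linarith
        then have "\<bar>\<psi> (x (n k) - f (x (n k)))\<bar> < 4" by (simp add: linear_diff[OF lin])
        then show ?case using e by (simp add: \<psi>_def abs_mult field_simps)
      qed
    qed
  qed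
qed

theorem theorem3p3:
  fixes C :: "'a::real_locally_convex set"
  assumes "metrizable_space (euclidean :: 'a topology)"
    and "C \<noteq> {}" "closed C" "convex C" "tvs_bounded C"
  shows "(\<forall>D. D \<noteq> {} \<and> closed D \<and> convex D \<and> D \<subseteq> C \<longrightarrow> weak_AFPP D) \<longleftrightarrow>
         \<not> (\<exists>x :: nat \<Rightarrow> 'a. range x \<subseteq> C \<and> ell1_sequence x)"
proof
  assume afpp: "\<forall>D. D \<noteq> {} \<and> closed D \<and> convex D \<and> D \<subseteq> C \<longrightarrow> weak_AFPP D"
  show "\<not> (\<exists>x :: nat \<Rightarrow> 'a. range x \<subseteq> C \<and> ell1_sequence x)"
  proof
    assume "\<exists>x :: nat \<Rightarrow> 'a. range x \<subseteq> C \<and> ell1_sequence x"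
    then obtain x :: "nat \<Rightarrow> 'a" where x: "range x \<subseteq> C" "ell1_sequence x" by blast
    obtain D where "D \<noteq> {}" "closed D" "convex D" "D \<subseteq> C" "\<not> weak_AFPP D"
      using ell1_sequence_imp_not_weak_AFPP[OF assms(3,4) x] by metis
    then show False using afpp by blast
  qed
next
  assume "\<not> (\<exists>x :: nat \<Rightarrow> 'a. range x \<subseteq> C \<and> ell1_sequence x)"
  then show "\<forall>D. D \<noteq> {} \<and> closed D \<and> convex D \<and> D \<subseteq> C \<longrightarrow> weak_AFPP D"
    using no_ell1_sequence_imp_weak_AFPP[OF assms(1,5)] by blast
qed

end
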